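(* For every integer $n\ge 1$, $$|RAI_{2n}(4321)|=|AI_{2n}(1234)|=M_n$$ and $$|RAI_{2n-1}(1234)|=|AI_{2n-1}(4321)|=|RAI_{2n-1}(4321)|=|AI_{2n-1}(1234)|=M_n-M_{n-2},$$ where $M_k$ is the $k$-th Motzkin number and $M_k=0$ for $k<0$.
   Context: Let $S_n$ be the set of permutations $\pi=\pi_1\ldots\pi_n$ of $\{1,\ldots,n\}$. A permutation is alternating if, for all $1\le i\le n-1$, $\pi_i<\pi_{i+1}$ if and only if $i$ is odd; it is reverse alternating if, for all $1\le i\le n-1$, $\pi_i>\pi_{i+1}$ if and only if $i$ is odd. $AI_n$ (resp. $RAI_n$) is the set of alternating (resp. reverse alternating) involutions ($\pi=\pi^{-1}$) in $S_n$. A permutation $\pi\in S_n$ avoids the pattern $\tau\in S_k$ if there are no indices $i_1<\cdots<i_k$ such that $\pi_{i_1}\ldots\pi_{i_k}$ is order-isomorphic to $\tau$; $AI_n(\tau)$ and $RAI_n(\tau)$ are the subsets of elements avoiding $\tau$. The Motzkin number $M_n$ ($n\ge 0$) is the number of Motzkin paths of length $n$, i.e. lattice paths from $(0,0)$ to $(n,0)$ with steps $U=(1,1)$, $D=(1,-1)$, $H=(1,0)$ that stay weakly above the $x$-axis (so $M_0=M_1=1$, $M_2=2$, $M_3=4$). *)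

theory Defs
  imports "HOL-Combinatorics.Permutations"
begin

text \<open>
  A permutation of \<open>{1..n}\<close> is a function \<open>\<pi> :: nat \<Rightarrow> nat\<close> with \<open>\<pi> permutes {1..n}\<close>; its one-line
  notation is \<open>\<pi> 1, \<dots>, \<pi> n\<close>. Being the identity outside \<open>{1..n}\<close>, it is determined by these values,
  so that cardinalities of sets of such functions count permutations.
\<close>

definition alternating :: "nat \<Rightarrow> (nat \<Rightarrow> nat) \<Rightarrow> bool" where
  "alternating n \<pi> \<longleftrightarrow> (\<forall>i\<in>{1..<n}. \<pi> i < \<pi> (i + 1) \<longleftrightarrow> odd i)"

definition reverse_alternating :: "nat \<Rightarrow> (nat \<Rightarrow> nat) \<Rightarrow> bool" where
  "reverse_alternating n \<pi> \<longleftrightarrow> (\<forall>i\<in>{1..<n}. \<pi> i > \<pi> (i + 1) \<longleftrightarrow> odd i)"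

text \<open>
  A pattern is given by its one-line notation as a list, e.g. \<open>[4, 3, 2, 1]\<close>. List positions start
  at 0, so \<open>f a\<close> is the (1-based) index in \<open>\<pi>\<close> of the entry that plays the role of \<open>\<tau> ! a\<close>.
\<close>

definition avoids :: "nat \<Rightarrow> (nat \<Rightarrow> nat) \<Rightarrow> nat list \<Rightarrow> bool" where
  "avoids n \<pi> \<tau> \<longleftrightarrow>
     \<not> (\<exists>f :: nat \<Rightarrow> nat.
           f ` {..<length \<tau>} \<subseteq> {1..n} \<and> strict_mono_on {..<length \<tau>} f \<and>
           (\<forall>a<length \<tau>. \<forall>b<length \<tau>. \<pi> (f a) < \<pi> (f b) \<longleftrightarrow> \<tau> ! a < \<tau> ! b))"

definition AI :: "nat \<Rightarrow> (nat \<Rightarrow> nat) set" where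
  "AI n = {\<pi>. \<pi> permutes {1..n} \<and> \<pi> = inv \<pi> \<and> alternating n \<pi>}"

definition RAI :: "nat \<Rightarrow> (nat \<Rightarrow> nat) set" where
  "RAI n = {\<pi>. \<pi> permutes {1..n} \<and> \<pi> = inv \<pi> \<and> reverse_alternating n \<pi>}"

definition AI_avoiding :: "nat \<Rightarrow> nat list \<Rightarrow> (nat \<Rightarrow> nat) set" where
  "AI_avoiding n \<tau> = {\<pi> \<in> AI n. avoids n \<pi> \<tau>}"

definition RAI_avoiding :: "nat \<Rightarrow> nat list \<Rightarrow> (nat \<Rightarrow> nat) set" where
  "RAI_avoiding n \<tau> = {\<pi> \<in> RAI n. avoids n \<pi> \<tau>}"

datatype motzkin_step = Up | Down | Horizontal

fun rise :: "motzkin_step \<Rightarrow> int" where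
  "rise Up = 1"
| "rise Down = -1"
| "rise Horizontal = 0"

text \<open>
  Every step advances the abscissa by 1, so a path of \<open>n\<close> steps starting at the origin is at
  abscissa \<open>k\<close> after \<open>k\<close> steps, and its ordinate there is \<open>height p k\<close>.
\<close>

definition height :: "motzkin_step list \<Rightarrow> nat \<Rightarrow> int" where
  "height p k = sum_list (map rise (take k p))"

definition motzkin_paths :: "nat \<Rightarrow> motzkin_step list set" where
  "motzkin_paths n = {p. length p = n \<and> (\<forall>k\<le>n. height p k \<ge> 0) \<and> height p n = 0}"

text \<open>
  Indices and values are integers, so that \<open>M\<^sub>k = 0\<close> for negative \<open>k\<close> is meaningful and the
  subtractions \<open>n - 2\<close> and \<open>M\<^sub>n - M\<^bsub>n-2\<^esub>\<close> are not truncated.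
\<close>

definition motzkin :: "int \<Rightarrow> int" where
  "motzkin k = (if k < 0 then 0 else int (card (motzkin_paths (nat k))))"

end

theory Submission
  imports Defs "HOL-Library.Infinite_Set"
begin

text \<open>
  An involution avoids 4321 iff no two of its 2-cycles are nested, so it is determined by the
  Motzkin word that marks openers, closers and fixed points of the cycles; a descent is a strict
  increase of the letters in the order up, horizontal, down. By Robinson-Schensted, involutions
  avoiding 1234 correspond to standard tableaux with at most three columns, that is, to ballot words
  in three letters, and there an ascent is a strict increase of the letters. In both cases the
  words to be counted increase exactly at every second position, so they split into pairs of
  letters, of which only three can occur. Reading the pairs as the letters of a shorter word turns
  the first kind into Motzkin paths. The second kind becomes a walk in a quarter plane, whose
  numbers of continuations are sums of Motzkin numbers (\<open>num_lattice_double_eq\<close>). In odd length,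
  reverse-complementation exchanges alternating and reverse alternating involutions.
\<close>

subsection \<open>Zigzag words in three letters\<close>

text \<open>\<open>Up\<close>, \<open>Horizontal\<close>, \<open>Down\<close> also serve as the
  letters 1, 2, 3 of a ballot word, so one splitting into pairs handles both kinds of words.
  Robinson-Schensted labels record rows, and there an ascent is a weak decrease; transposing the
  tableau makes it a strict increase and turns the bound three on the first row into an alphabet of
  three letters. Edge labels keep the correspondence local, and the diagram of an involution is
  symmetric: its right border repeats its top border, so a single word suffices to run the rules
  backwards. The difference M_n - M_(n-2) stems from the unpaired first letter of a word of odd
  length 2n - 1: three letters and n - 2 further pairs. Motzkin words can then stand at the heights
  0, 1, 1, 2; ballot words only at the point (1, 1), whose constituents have \<open>i + j\<close>
  equal to the same numbers.\<close>

fun rank :: "motzkin_step \<Rightarrow> nat" where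
  "rank Up = 0"
| "rank Horizontal = 1"
| "rank Down = 2"

lemma rank_le_2: "rank s \<le> 2"
  by (cases s) auto

lemma rank_inject [simp]: "rank s = rank t \<longleftrightarrow> s = t"
  by (cases s; cases t) auto

fun motzkin_from :: "nat \<Rightarrow> motzkin_step list \<Rightarrow> bool" where
  "motzkin_from h [] \<longleftrightarrow> h = 0"
| "motzkin_from h (Up # p) \<longleftrightarrow> motzkin_from (Suc h) p"
| "motzkin_from h (Horizontal # p) \<longleftrightarrow> motzkin_from h p"
| "motzkin_from h (Down # p) \<longleftrightarrow> h > 0 \<and> motzkin_from (h - 1) p"

text \<open>\<open>a\<close> and \<open>b\<close> are the surpluses of \<open>Up\<close> over
  \<open>Horizontal\<close> and of \<open>Horizontal\<close> over \<open>Down\<close>, that is, the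
  differences of consecutive row lengths of a growing partition with three rows. The end point is
  free.\<close>

fun lattice_from :: "nat \<Rightarrow> nat \<Rightarrow> motzkin_step list \<Rightarrow> bool" where
  "lattice_from a b [] \<longleftrightarrow> True"
| "lattice_from a b (Up # p) \<longleftrightarrow> lattice_from (Suc a) b p"
| "lattice_from a b (Horizontal # p) \<longleftrightarrow> a > 0 \<and> lattice_from (a - 1) (Suc b) p"
| "lattice_from a b (Down # p) \<longleftrightarrow> b > 0 \<and> lattice_from a (b - 1) p"

fun zigzag :: "bool \<Rightarrow> motzkin_step list \<Rightarrow> bool" where
  "zigzag up (s # t # p) \<longleftrightarrow> (rank s < rank t \<longleftrightarrow> up) \<and> zigzag (\<not> up) (t # p)"
| "zigzag up p \<longleftrightarrow> True"

lemma zigzag_iff_nth: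
  "zigzag up p \<longleftrightarrow> (\<forall>i. Suc i < length p \<longrightarrow> (rank (p ! i) < rank (p ! Suc i) \<longleftrightarrow> (even i \<longleftrightarrow> up)))"
proof (induction up p rule: zigzag.induct)
  case (1 up s t p)
  then show ?case
    by (auto simp: All_less_Suc2)
qed auto

lemma All_le_Suc2: "(\<forall>k\<le>Suc n. P k) \<longleftrightarrow> P 0 \<and> (\<forall>k\<le>n. P (Suc k))"
  using All_less_Suc2[of "Suc n" P] by (simp add: less_Suc_eq_le)

lemma motzkin_from_iff_height:
  "motzkin_from h p \<longleftrightarrow> (\<forall>k\<le>length p. int h + height p k \<ge> 0) \<and> int h + height p (length p) = 0"
proof (induction h p rule: motzkin_from.induct)
  case (4 h p)
  show ?case
  proof (cases h)
    case 0
    then show ?thesis by (force simp: height_def All_le_Suc2)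
  next
    case (Suc h')
    with 4 show ?thesis by (simp add: height_def All_le_Suc2 algebra_simps)
  qed
qed (simp_all add: height_def All_le_Suc2 algebra_simps)

lemma motzkin_paths_eq: "motzkin_paths n = {p. length p = n \<and> motzkin_from 0 p}"
  by (auto simp: motzkin_paths_def motzkin_from_iff_height)

lemma lattice_from_iff_count:
  "lattice_from a b p \<longleftrightarrow> (\<forall>k\<le>length p.
     count_list (take k p) Horizontal \<le> a + count_list (take k p) Up \<and>
     count_list (take k p) Down \<le> b + count_list (take k p) Horizontal)"
proof (induction a b p rule: lattice_from.induct)
  case (3 a b p)
  show ?case
  proof (cases a)
    case 0
    then show ?thesis by (force simp: All_le_Suc2)
  next
    case (Suc a')
    with 3 show ?thesis by (simp add: All_le_Suc2 algebra_simps)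
  qed
next
  case (4 a b p)
  show ?case
  proof (cases b)
    case 0
    then show ?thesis by (force simp: All_le_Suc2)
  next
    case (Suc b')
    with 4 show ?thesis by (simp add: All_le_Suc2 algebra_simps)
  qed
qed (simp_all add: All_le_Suc2 algebra_simps)

section \<open>Recursions by the first letter\<close>

lemma UNIV_motzkin_step: "UNIV = {Up, Horizontal, Down}"
  by (auto intro: motzkin_step.exhaust)

lemma finite_words: "finite {p :: motzkin_step list. length p = n \<and> P p}"
proof -
  have "finite {p :: motzkin_step list. set p \<subseteq> UNIV \<and> length p = n}"
    by (intro finite_lists_length_eq) (simp add: UNIV_motzkin_step)
  then show ?thesis
    by (rule rev_finite_subset) auto
qed

lemma card_words_Suc:
  "card {q. length q = Suc n \<and> P q} =
     card {p. length p = n \<and> P (Up # p)} + card {p. length p = n \<and> P (Horizontal # p)} +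
     card {p. length p = n \<and> P (Down # p)}"
proof -
  have "{q. length q = Suc n \<and> P q} = (\<Union>s\<in>UNIV. (#) s ` {p. length p = n \<and> P (s # p)})"
    by (auto simp: length_Suc_conv)
  also have "card \<dots> = (\<Sum>s\<in>UNIV. card ((#) s ` {p. length p = n \<and> P (s # p)}))"
    by (rule card_UN_disjoint) (auto simp: UNIV_motzkin_step finite_words)
  also have "\<dots> = (\<Sum>s\<in>UNIV. card {p. length p = n \<and> P (s # p)})"
    by (intro sum.cong card_image refl) auto
  finally show ?thesis
    by (simp add: UNIV_motzkin_step)
qed

definition num_motzkin_from :: "nat \<Rightarrow> nat \<Rightarrow> nat" where
  "num_motzkin_from n h = card {p. length p = n \<and> motzkin_from h p}"

lemma num_motzkin_from_0: "num_motzkin_from 0 h = (if h = 0 then 1 else 0)"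
proof -
  have "{p. length p = 0 \<and> motzkin_from h p} = (if h = 0 then {[]} else {})"
    by auto
  then show ?thesis by (simp add: num_motzkin_from_def)
qed

lemma num_motzkin_from_Suc:
  "num_motzkin_from (Suc n) h =
     num_motzkin_from n (Suc h) + num_motzkin_from n h + (if h = 0 then 0 else num_motzkin_from n (h - 1))"
  by (auto simp: num_motzkin_from_def card_words_Suc)

lemma motzkin_of_nat: "motzkin (int n) = int (num_motzkin_from n 0)"
  by (simp add: motzkin_def motzkin_paths_eq num_motzkin_from_def)

text \<open>Two steps from height 0 lead to 0 in two ways, to 1 in two ways and to 2 in one way; the
  subtraction cancels one of the returns to 0.\<close>

lemma motzkin_diff:
  "motzkin (int (n + 2)) - motzkin (int n) =
     int (num_motzkin_from n 0 + 2 * num_motzkin_from n 1 + num_motzkin_from n 2)"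
  by (simp only: motzkin_of_nat) (simp add: num_motzkin_from_Suc eval_nat_numeral)

section \<open>Zigzag words as words of pairs\<close>

fun double_step :: "motzkin_step \<Rightarrow> motzkin_step list" where
  "double_step Up = [Up, Horizontal]"
| "double_step Horizontal = [Up, Down]"
| "double_step Down = [Horizontal, Down]"

definition double :: "motzkin_step list \<Rightarrow> motzkin_step list" where
  "double p = concat (map double_step p)"

lemma double_simps [simp]:
  "double [] = []" "double (s # p) = double_step s @ double p"
  by (simp_all add: double_def)

lemma length_double [simp]: "length (double p) = 2 * length p"
proof (induction p)
  case (Cons s p)
  then show ?case by (cases s) auto
qed simp

lemma inj_double: "inj double"
proof (rule injI)
  fix p q :: "motzkin_step list"
  assume "double p = double q"
  then show "p = q"
  proof (induction p arbitrary: q)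
    case Nil
    then show ?case by (cases q rule: list.exhaust; cases "hd q") auto
  next
    case (Cons s p)
    then obtain t r where "q = t # r"
      by (cases q; cases s) auto
    with Cons show ?case by (cases s; cases t) auto
  qed
qed

text \<open>A pair ends in \<open>Horizontal\<close> or \<open>Down\<close> and begins with
  \<open>Up\<close> or \<open>Horizontal\<close>, so there is never a strict increase from one pair
  to the next: pairs combine freely.\<close>

lemma zigzag_double: "zigzag True (double p)"
proof (induction p)
  case (Cons s p)
  show ?case
  proof (cases p)
    case Nil
    then show ?thesis by (cases s) auto
  next
    case (Cons t r)
    with Cons.IH show ?thesis by (cases s; cases t) auto
  qed
qed simp

lemma zigzag_even_length_imp_double:
  assumes "zigzag True q" "length q = 2 * n"
  obtains p where "q = double p" "length p = n"
proof -
  have "\<exists>p. q = double p \<and> length p = n"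
    using assms
  proof (induction n arbitrary: q)
    case (Suc n)
    then obtain s t r where q: "q = s # t # r" "length r = 2 * n"
      by (metis One_nat_def Suc_length_conv add_Suc_right mult_2 plus_1_eq_Suc add_Suc)
    have "zigzag True r"
      using Suc.prems(1) q(1) by (cases r) auto
    then obtain p where "r = double p" "length p = n"
      using Suc.IH q(2) by blast
    moreover obtain u where "double_step u = [s, t]"
      using Suc.prems(1) q(1) by (cases s; cases t) (auto intro: that[of Up] that[of Horizontal] that[of Down])
    ultimately show ?case using q(1) by (intro exI[of _ "u # p"]) auto
  qed simp
  then show thesis using that by blast
qed

lemma zigzag_words_eq_double:
  "{q. length q = 2 * n \<and> zigzag True q} = double ` {p. length p = n}"
  using zigzag_double by (auto elim: zigzag_even_length_imp_double)

lemma card_zigzag_even: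
  "card {q. length q = 2 * n \<and> P q \<and> zigzag True q} = card {p. length p = n \<and> P (double p)}"
proof -
  have "{q. length q = 2 * n \<and> P q \<and> zigzag True q} = double ` {p. length p = n \<and> P (double p)}"
    using zigzag_words_eq_double[of n] by auto
  then show ?thesis
    using card_image[OF inj_on_subset[OF inj_double subset_UNIV]] by metis
qed

text \<open>The first letter of a pair is never \<open>Down\<close>, so \<open>Horizontal\<close> and \<open>Down\<close> may precede any pair,
  but \<open>Up\<close> only a pair that begins with \<open>Up\<close>.\<close>

lemma card_zigzag_odd:
  "card {q. length q = 2 * n + 3 \<and> P q \<and> zigzag False q} =
     (\<Sum>u\<in>{[Up, Up, Horizontal], [Up, Up, Down], [Horizontal, Up, Horizontal], [Horizontal, Up, Down],
          [Horizontal, Horizontal, Down], [Down, Up, Horizontal], [Down, Up, Down], [Down, Horizontal, Down]}.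
        card {p. length p = n \<and> P (u @ double p)})"
    (is "card ?A = sum _ ?U")
proof -
  have "?A = (\<Union>u\<in>?U. (\<lambda>p. u @ double p) ` {p. length p = n \<and> P (u @ double p)})" (is "_ = ?B")
  proof (intro equalityI subsetI)
    fix q assume q: "q \<in> ?A"
    then obtain s r where s: "q = s # r" "length r = 2 * Suc n"
      by (cases q) auto
    have "zigzag True r"
      using q s by (cases r) auto
    then obtain p where p: "r = double p" "length p = Suc n"
      using s(2) zigzag_even_length_imp_double by blast
    then obtain t p' where t: "p = t # p'" "length p' = n"
      by (cases p) auto
    then have "s # double_step t \<in> ?U" "q = (s # double_step t) @ double p'"
      using q s p by (cases s; cases t; auto)+
    then show "q \<in> ?B" using q t by blast
  next
    fix q assume "q \<in> ?B"
    then obtain u p where u: "u \<in> ?U" "q = u @ double p" "length p = n" "P (u @ double p)"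
      using \<open>q \<in> ?B\<close> by (elim UN_E imageE CollectE conjE) (rule that)
    then obtain s t where "u = s # double_step t" "\<not> rank s < rank (hd (double_step t))"
      by (auto intro: that[of _ Up] that[of _ Horizontal] that[of _ Down])
    moreover have "zigzag True (double (t # p))"
      by (rule zigzag_double)
    ultimately have "zigzag False q"
      using u(2) by (cases t) auto
    with u show "q \<in> ?A" by auto
  qed
  also have "card \<dots> = (\<Sum>u\<in>?U. card ((\<lambda>p. u @ double p) ` {p. length p = n \<and> P (u @ double p)}))"
  proof (rule card_UN_disjoint)
    show "\<forall>u\<in>?U. finite ((\<lambda>p. u @ double p) ` {p. length p = n \<and> P (u @ double p)})"
      by (intro ballI finite_imageI finite_words)
  qed auto
  also have "\<dots> = (\<Sum>u\<in>?U. card {p. length p = n \<and> P (u @ double p)})"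
    by (intro sum.cong card_image inj_onI refl) (auto dest: injD[OF inj_double])
  finally show ?thesis .
qed

text \<open>This is what the naming of the pairs is made for: each pair has the rise of its name,
  and the only one that can fail, \<open>[Horizontal, Down]\<close>, fails exactly at height
  0.\<close>

lemma motzkin_from_double: "motzkin_from h (double p) \<longleftrightarrow> motzkin_from h p"
proof (induction p arbitrary: h)
  case (Cons s p)
  then show ?case by (cases s) auto
qed simp

section \<open>Walks in the quarter plane\<close>

definition num_lattice_double :: "nat \<Rightarrow> nat \<Rightarrow> nat \<Rightarrow> nat" where
  "num_lattice_double n a b = card {p. length p = n \<and> lattice_from a b (double p)}"

lemma num_lattice_double_0: "num_lattice_double 0 a b = 1"
proof -
  have "{p. length p = 0 \<and> lattice_from a b (double p)} = {[]}"
    by auto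
  then show ?thesis by (simp add: num_lattice_double_def)
qed

text \<open>The pairs move \<open>(a, b)\<close> by (0, 1), (1, -1) and (-1, 0), the weights of the
  dual of the standard representation of SL(3).\<close>

lemma num_lattice_double_Suc:
  "num_lattice_double (Suc n) a b = num_lattice_double n a (Suc b)
     + (if b = 0 then 0 else num_lattice_double n (Suc a) (b - 1))
     + (if a = 0 then 0 else num_lattice_double n (a - 1) b)"
  by (auto simp: num_lattice_double_def card_words_Suc)

text \<open>The pairs \<open>(i, j)\<close> index the constituents, of dimension \<open>i + j + 1\<close>, of the restriction to \<open>SL\<^sub>2\<close>
  of the irreducible representation of \<open>SL\<^sub>3\<close> with highest weight \<open>(a, b)\<close>. The recursion is the
  Pieri rule for the dual of the standard representation of \<open>SL\<^sub>3\<close>, which restricts to the standard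
  representation of \<open>SL\<^sub>2\<close> plus a trivial one.\<close>

lemma num_lattice_double_eq:
  "num_lattice_double n a b = (\<Sum>i<Suc a. \<Sum>j<Suc b. num_motzkin_from n (i + j))"
proof (induction n arbitrary: a b)
  case 0
  have "(\<Sum>i<Suc a. \<Sum>j<Suc b. num_motzkin_from 0 (i + j)) = (\<Sum>i<Suc a. if i = 0 then 1 else 0)"
    by (intro sum.cong refl) (simp add: num_motzkin_from_0 sum.lessThan_Suc_shift del: sum.lessThan_Suc)
  also have "\<dots> = 1" by (simp add: sum.lessThan_Suc_shift del: sum.lessThan_Suc)
  finally show ?case by (simp add: num_lattice_double_0)
next
  case (Suc n)
  define m where "m = num_motzkin_from n"
  define F where "F = (\<lambda>a b. \<Sum>i<a. \<Sum>j<b. m (i + j))"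
  have up: "(\<Sum>i<A. \<Sum>j<B. m (Suc (i + j))) + (\<Sum>i<A. m i) = F A (Suc B)" for A B
    by (simp add: F_def sum.lessThan_Suc_shift sum.distrib del: sum.lessThan_Suc)
  have down: "(\<Sum>i<Suc a. \<Sum>j<Suc b. if i + j = 0 then 0 else m (i + j - 1)) = F (Suc a) b + (\<Sum>i<a. m i)"
  proof -
    have "(\<Sum>j<Suc b. if i + j = 0 then 0 else m (i + j - 1)) = (if i = 0 then 0 else m (i - 1)) + (\<Sum>j<b. m (i + j))" for i
      by (simp add: sum.lessThan_Suc_shift del: sum.lessThan_Suc)
    then have "(\<Sum>i<Suc a. \<Sum>j<Suc b. if i + j = 0 then 0 else m (i + j - 1))
        = (\<Sum>i<Suc a. if i = 0 then 0 else m (i - 1)) + F (Suc a) b"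
      by (simp add: F_def sum.distrib del: sum.lessThan_Suc)
    then show ?thesis
      by (simp add: sum.lessThan_Suc_shift del: sum.lessThan_Suc)
  qed
  have F_0: "F A 0 = 0" "F 0 B = 0" for A B
    by (simp_all add: F_def)
  have row: "F (Suc A) B = F A B + (\<Sum>j<B. m (A + j))" for A B
    by (simp add: F_def)
  have edge: "(\<Sum>j<Suc b. m (a + j)) = m a + (\<Sum>j<b. m (Suc a + j))"
    by (simp add: sum.lessThan_Suc_shift del: sum.lessThan_Suc)
  have "(\<Sum>i<Suc a. \<Sum>j<Suc b. num_motzkin_from (Suc n) (i + j))
      = (\<Sum>i<Suc a. \<Sum>j<Suc b. m (Suc (i + j))) + F (Suc a) (Suc b)
        + (\<Sum>i<Suc a. \<Sum>j<Suc b. if i + j = 0 then 0 else m (i + j - 1))"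
    by (simp add: num_motzkin_from_Suc F_def sum.distrib del: sum.lessThan_Suc flip: m_def cong: if_cong)
  moreover have "(\<Sum>i<Suc a. m i) = (\<Sum>i<a. m i) + m a"
    by simp
  \<comment> \<open>The summand \<open>m a\<close> is carried along to avoid subtraction:
    \<open>up\<close> involves the border sum up to \<open>a\<close>, \<open>down\<close> only the
    part below \<open>a\<close>. It cancels below, where the last row of
    \<open>F (Suc a) (Suc b)\<close> without its first entry \<open>m a\<close> becomes the row that
    extends \<open>F (Suc a) b\<close> to \<open>F (Suc (Suc a)) b\<close>.\<close>
  ultimately have "(\<Sum>i<Suc a. \<Sum>j<Suc b. num_motzkin_from (Suc n) (i + j)) + m a
      = F (Suc a) (Suc (Suc b)) + F (Suc a) (Suc b) + F (Suc a) b"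
    using up[where A = "Suc a" and B = "Suc b"] down by linarith
  also have "\<dots> = F (Suc a) (Suc (Suc b)) + F (Suc (Suc a)) b + F a (Suc b) + m a"
    using row[where A = a and B = "Suc b"] row[where A = "Suc a" and B = b] edge by linarith
  finally have "(\<Sum>i<Suc a. \<Sum>j<Suc b. num_motzkin_from (Suc n) (i + j))
      = F (Suc a) (Suc (Suc b)) + F (Suc (Suc a)) b + F a (Suc b)"
    by simp
  moreover have "num_lattice_double n a b = F (Suc a) (Suc b)" for a b
    by (simp only: Suc.IH F_def m_def)
  ultimately show ?case
    by (cases a; cases b) (simp_all only: num_lattice_double_Suc F_0, simp_all)
qed

lemma card_motzkin_zigzag_even:
  "int (card {q. length q = 2 * n \<and> motzkin_from 0 q \<and> zigzag True q}) = motzkin (int n)"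
  by (simp add: card_zigzag_even motzkin_from_double motzkin_of_nat num_motzkin_from_def)

lemma card_lattice_zigzag_even:
  "int (card {q. length q = 2 * n \<and> lattice_from 0 0 q \<and> zigzag True q}) = motzkin (int n)"
  using num_lattice_double_eq[of n 0 0]
  by (simp add: card_zigzag_even motzkin_of_nat num_lattice_double_def)

lemma odd_length_cases:
  fixes n :: nat
  assumes "n \<ge> 1"
  obtains "n = 1" | k where "n = k + 2" "2 * n - 1 = 2 * k + 3"
  using assms by (cases n; cases "n - 1") auto

lemma card_motzkin_zigzag_odd:
  assumes "n \<ge> 1"
  shows "int (card {q. length q = 2 * n - 1 \<and> motzkin_from 0 q \<and> zigzag False q})
    = motzkin (int n) - motzkin (int n - 2)"
  using assms
proof (cases rule: odd_length_cases)
  case 1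
  have "num_motzkin_from 1 0 = 1"
    by (simp add: num_motzkin_from_Suc num_motzkin_from_0)
  moreover have "motzkin (int 1 - 2) = 0"
    by (simp add: motzkin_def)
  moreover have "{q. length q = Suc 0 \<and> motzkin_from 0 q \<and> zigzag False q} = {q. length q = 1 \<and> motzkin_from 0 q}"
    by (auto simp: length_Suc_conv)
  ultimately show ?thesis
    unfolding 1 motzkin_of_nat num_motzkin_from_def by simp
next
  case (2 k)
  \<comment> \<open>Four of the eight prefixes stay weakly above the axis; they end at the heights
    2, 1, 1, 0.\<close>
  then show ?thesis
    unfolding 2(2) card_zigzag_odd
    using motzkin_diff[of k] by (simp add: 2(1) motzkin_from_double num_motzkin_from_def eval_nat_numeral)
qed

lemma card_lattice_zigzag_odd:
  assumes "n \<ge> 1"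
  shows "int (card {q. length q = 2 * n - 1 \<and> lattice_from 0 0 q \<and> zigzag False q})
    = motzkin (int n) - motzkin (int n - 2)"
  using assms
proof (cases rule: odd_length_cases)
  case 1
  have "motzkin (int 1) = 1"
    by (simp only: motzkin_of_nat) (simp add: num_motzkin_from_Suc num_motzkin_from_0)
  moreover have "motzkin (int 1 - 2) = 0"
    by (simp add: motzkin_def)
  moreover have "{q. length q = 1 \<and> lattice_from 0 0 q \<and> zigzag False q} = {[Up]}"
  proof (intro equalityI subsetI)
    fix q assume "q \<in> {q. length q = 1 \<and> lattice_from 0 0 q \<and> zigzag False q}"
    then obtain s where "q = [s]" "lattice_from 0 0 [s]"
      by (auto simp: length_Suc_conv)
    then show "q \<in> {[Up]}" by (cases s) auto
  qed auto
  ultimately show ?thesis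
    unfolding 1 by simp
next
  case (2 k)
  \<comment> \<open>Only the prefix \<open>[Up, Up, Horizontal]\<close> satisfies the ballot
    condition; it ends at the point (1, 1).\<close>
  then show ?thesis
    unfolding 2(2) card_zigzag_odd
    using motzkin_diff[of k] num_lattice_double_eq[of k 1 1]
    by (simp add: 2(1) num_lattice_double_def eval_nat_numeral)
qed

subsection \<open>Involutions avoiding 4321\<close>

definition involutions :: "nat \<Rightarrow> (nat \<Rightarrow> nat) set" where
  "involutions N = {\<pi>. (\<forall>i. \<pi> (\<pi> i) = i) \<and> (\<forall>i. i \<notin> {1..N} \<longrightarrow> \<pi> i = i)}"

lemma involutions_eq: "involutions N = {\<pi>. \<pi> permutes {1..N} \<and> \<pi> = inv \<pi>}"
proof (intro equalityI subsetI CollectI conjI)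
  fix \<pi> assume \<pi>: "\<pi> \<in> involutions N"
  then have "\<pi> (\<pi> i) = i" for i by (simp add: involutions_def)
  then have "\<exists>!x. \<pi> x = y" for y by metis
  with \<pi> show "\<pi> permutes {1..N}"
    by (simp add: permutes_def involutions_def)
  from \<pi> show "\<pi> = inv \<pi>"
    by (intro sym[OF inv_unique_comp]) (auto simp: involutions_def fun_eq_iff)
next
  fix \<pi> :: "nat \<Rightarrow> nat" assume \<pi>: "\<pi> \<in> {\<pi>. \<pi> permutes {1..N} \<and> \<pi> = inv \<pi>}"
  then have "\<pi> (\<pi> i) = i" for i
    using permutes_inverses(1)[of \<pi> "{1..N}" i] by simp
  with \<pi> show "\<pi> \<in> involutions N"
    by (auto simp: involutions_def permutes_def)
qed

lemma involutionsD:
  assumes "\<pi> \<in> involutions N"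
  shows "\<pi> (\<pi> i) = i" "i \<notin> {1..N} \<Longrightarrow> \<pi> i = i" "i \<in> {1..N} \<Longrightarrow> \<pi> i \<in> {1..N}"
    "\<pi> i = \<pi> j \<longleftrightarrow> i = j"
  using assms unfolding involutions_def by (auto; metis)+

lemma avoids_length_4:
  assumes "length \<tau> = 4"
  shows "avoids N \<pi> \<tau> \<longleftrightarrow> \<not> (\<exists>a b c d. 1 \<le> a \<and> a < b \<and> b < c \<and> c < d \<and> d \<le> N \<and>
    (\<forall>k<4. \<forall>l<4. \<pi> ([a, b, c, d] ! k) < \<pi> ([a, b, c, d] ! l) \<longleftrightarrow> \<tau> ! k < \<tau> ! l))"
    (is "_ \<longleftrightarrow> \<not> ?P")
proof -
  have "(\<exists>f. f ` {..<4} \<subseteq> {1..N} \<and> strict_mono_on {..<4} f \<and>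
          (\<forall>a<4. \<forall>b<4. \<pi> (f a) < \<pi> (f b) \<longleftrightarrow> \<tau> ! a < \<tau> ! b)) \<longleftrightarrow> ?P" (is "(\<exists>f. ?Q f) \<longleftrightarrow> _")
  proof
    assume "\<exists>f. ?Q f"
    then obtain f where f: "?Q f" ..
    define xs where "xs = [f 0, f 1, f 2, f 3]"
    have nth: "xs ! k = f k" if "k < 4" for k
      using that by (auto simp: xs_def less_Suc_eq numeral_eq_Suc)
    have "f k \<in> {1..N}" if "k < 4" for k
      using f that by blast
    from this[of 0] this[of 3] have "1 \<le> f 0" "f 3 \<le> N"
      by auto
    moreover have "f k < f l" if "k < l" "l < 4" for k l
      using f that strict_mono_onD[of "{..<4}" f k l] by simp
    from this[of 0 1] this[of 1 2] this[of 2 3] have "f 0 < f 1" "f 1 < f 2" "f 2 < f 3"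
      by auto
    moreover have "\<forall>k<4. \<forall>l<4. \<pi> (xs ! k) < \<pi> (xs ! l) \<longleftrightarrow> \<tau> ! k < \<tau> ! l"
      using f by (simp add: nth)
    ultimately show ?P
      unfolding xs_def by blast
  next
    assume ?P
    then obtain a b c d where *: "1 \<le> a" "a < b" "b < c" "c < d" "d \<le> N"
      "\<forall>k<4. \<forall>l<4. \<pi> ([a, b, c, d] ! k) < \<pi> ([a, b, c, d] ! l) \<longleftrightarrow> \<tau> ! k < \<tau> ! l"
      by blast
    moreover have "{..<4 :: nat} = {0, 1, 2, 3}"
      by auto
    ultimately have "?Q (nth [a, b, c, d])"
      by (auto simp: strict_mono_on_def)
    then show "\<exists>f. ?Q f" by blast
  qed
  then show ?thesis
    unfolding avoids_def assms by simp
qed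

lemma avoids_4321_iff:
  "avoids N \<pi> [4, 3, 2, 1] \<longleftrightarrow>
     \<not> (\<exists>a b c d. 1 \<le> a \<and> a < b \<and> b < c \<and> c < d \<and> d \<le> N \<and> \<pi> a > \<pi> b \<and> \<pi> b > \<pi> c \<and> \<pi> c > \<pi> d)"
proof -
  have *: "(\<forall>k<4. \<forall>l<4. \<pi> ([a, b, c, d] ! k) < \<pi> ([a, b, c, d] ! l) \<longleftrightarrow> ([4, 3, 2, 1] :: nat list) ! k < ([4, 3, 2, 1] :: nat list) ! l)
      \<longleftrightarrow> \<pi> a > \<pi> b \<and> \<pi> b > \<pi> c \<and> \<pi> c > \<pi> d" for a b c d
    by (simp add: numeral_eq_Suc All_less_Suc) (meson less_asym less_trans)
  show ?thesis
    by (subst avoids_length_4, simp) (simp only: *)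
qed

lemma avoids_1234_iff:
  "avoids N \<pi> [1, 2, 3, 4] \<longleftrightarrow>
     \<not> (\<exists>a b c d. 1 \<le> a \<and> a < b \<and> b < c \<and> c < d \<and> d \<le> N \<and> \<pi> a < \<pi> b \<and> \<pi> b < \<pi> c \<and> \<pi> c < \<pi> d)"
proof -
  have *: "(\<forall>k<4. \<forall>l<4. \<pi> ([a, b, c, d] ! k) < \<pi> ([a, b, c, d] ! l) \<longleftrightarrow> ([1, 2, 3, 4] :: nat list) ! k < ([1, 2, 3, 4] :: nat list) ! l)
      \<longleftrightarrow> \<pi> a < \<pi> b \<and> \<pi> b < \<pi> c \<and> \<pi> c < \<pi> d" for a b c d
    by (simp add: numeral_eq_Suc All_less_Suc) (meson less_asym less_trans)
  show ?thesis
    by (subst avoids_length_4, simp) (simp only: *)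
qed

definition nonnesting :: "(nat \<Rightarrow> nat) \<Rightarrow> bool" where
  "nonnesting \<pi> \<longleftrightarrow> \<not> (\<exists>i j. i < j \<and> j < \<pi> j \<and> \<pi> j < \<pi> i)"

lemma nonnestingD: "nonnesting \<pi> \<Longrightarrow> i < j \<Longrightarrow> j < \<pi> j \<Longrightarrow> \<pi> i \<le> \<pi> j"
  unfolding nonnesting_def by (metis not_less)

text \<open>Of the two middle entries of a 4321 pattern, the first lies above the diagonal, or else the
  second lies below it; in either case the pattern contains two points on the same side.\<close>

lemma avoids_4321_iff_nonnesting:
  assumes \<pi>: "\<pi> \<in> involutions N"
  shows "avoids N \<pi> [4, 3, 2, 1] \<longleftrightarrow> nonnesting \<pi>"
proof
  assume avoid: "avoids N \<pi> [4, 3, 2, 1]"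
  show "nonnesting \<pi>"
    unfolding nonnesting_def
  proof (safe, goal_cases)
    case (1 i j)
    then have "\<pi> i \<noteq> i" by linarith
    then have "i \<in> {1..N}" using involutionsD[OF \<pi>] by metis
    moreover have "\<pi> i \<in> {1..N}"
      using calculation involutionsD[OF \<pi>] by metis
    \<comment> \<open>The pattern sits at the positions \<open>i\<close>, \<open>j\<close>,
      \<open>\<pi> j\<close>, \<open>\<pi> i\<close>, whose values are these four numbers in reverse
      order.\<close>
    ultimately show False
      using avoid 1 involutionsD(1)[OF \<pi>] unfolding avoids_4321_iff
      by (metis atLeastAtMost_iff)
  qed
next
  assume nn: "nonnesting \<pi>"
  show "avoids N \<pi> [4, 3, 2, 1]"
    unfolding avoids_4321_iff
  proof (safe, goal_cases)
    case (1 a b c d)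
    show False
    proof (cases "b < \<pi> b")
      case True
      with 1 nn show False by (auto simp: nonnesting_def)
    next
      case False
      with 1 have "\<pi> d < \<pi> c" "\<pi> c < c" by auto
      then show False
        using nonnestingD[OF nn, of "\<pi> d" "\<pi> c"] 1 by (simp add: involutionsD(1)[OF \<pi>])
    qed
  qed
qed

section \<open>Involutions without nested cycles as Motzkin paths\<close>

definition step_type :: "nat \<Rightarrow> nat \<Rightarrow> motzkin_step" where
  "step_type i j = (if i < j then Up else if j < i then Down else Horizontal)"

lemma step_type_eq_iff [simp]:
  "step_type i j = Up \<longleftrightarrow> i < j" "step_type i j = Down \<longleftrightarrow> j < i" "step_type i j = Horizontal \<longleftrightarrow> i = j"
  by (auto simp: step_type_def)

text \<open>Without nesting, an opener at \<open>Suc i\<close> forces an ascent, and so does a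
  closer at \<open>i\<close>. Otherwise \<open>\<pi> i \<ge> i\<close> and
  \<open>\<pi> (Suc i) \<le> Suc i\<close>, and this is a descent unless both are fixed points. The
  types in these descents are exactly the strict increases.\<close>

lemma nonnesting_descent_iff:
  assumes \<pi>: "\<pi> \<in> involutions N" and nn: "nonnesting \<pi>"
  shows "\<pi> (Suc i) < \<pi> i \<longleftrightarrow> rank (step_type i (\<pi> i)) < rank (step_type (Suc i) (\<pi> (Suc i)))"
proof -
  note inv = involutionsD[OF \<pi>]
  have neq: "\<pi> i \<noteq> \<pi> (Suc i)"
    by (simp add: inv(4))
  have up: "\<pi> i < \<pi> (Suc i)" if "Suc i < \<pi> (Suc i)"
    using nonnestingD[OF nn, of i "Suc i"] that neq by auto
  have down: "\<pi> i < \<pi> (Suc i)" if "\<pi> i < i"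
    using nonnestingD[OF nn, of "\<pi> (Suc i)" "\<pi> i"] that neq by (fastforce simp: inv(1))
  have fix1: "\<pi> (Suc i) \<noteq> i" if "\<pi> i = i"
    using inv(1)[of "Suc i"] that by auto
  have fix2: "\<pi> i \<noteq> Suc i" if "\<pi> (Suc i) = Suc i"
    using inv(1)[of i] that by auto
  show ?thesis
    using up down fix1 fix2 neq by (auto simp: step_type_def)
qed

definition type_word :: "nat \<Rightarrow> (nat \<Rightarrow> nat) \<Rightarrow> motzkin_step list" where
  "type_word N \<pi> = map (\<lambda>i. step_type i (\<pi> i)) [1..<Suc N]"

lemma length_type_word [simp]: "length (type_word N \<pi>) = N"
  by (simp add: type_word_def)

lemma nth_type_word [simp]: "i < N \<Longrightarrow> type_word N \<pi> ! i = step_type (Suc i) (\<pi> (Suc i))"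
  by (simp add: type_word_def del: upt_Suc)

lemma card_filter_Suc:
  "card {i \<in> {1..Suc k}. P i} = card {i \<in> {1..k}. P i} + (if P (Suc k) then 1 else 0)"
proof -
  have "{i \<in> {1..Suc k}. P i} = {i \<in> {1..k}. P i} \<union> (if P (Suc k) then {Suc k} else {})"
    by (auto simp: le_Suc_eq)
  then show ?thesis by simp
qed

lemma height_eq_card:
  "k \<le> length p \<Longrightarrow>
    height p k = int (card {i \<in> {1..k}. p ! (i - 1) = Up}) - int (card {i \<in> {1..k}. p ! (i - 1) = Down})"
proof (induction k)
  case (Suc k)
  then show ?case
    unfolding card_filter_Suc
    by (cases "p ! k") (auto simp: height_def take_Suc_conv_app_nth)
qed (simp add: height_def)

text \<open>\<open>\<pi>\<close> maps the closers up to \<open>k\<close> injectively to openers up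
  to \<open>k\<close>; for \<open>k = N\<close> it also maps the openers to closers.\<close>

lemma type_word_in_motzkin_paths:
  assumes \<pi>: "\<pi> \<in> involutions N"
  shows "type_word N \<pi> \<in> motzkin_paths N"
proof -
  note inv = involutionsD[OF \<pi>]
  define E where "E k = {i \<in> {1..k}. i < \<pi> i}" for k
  define D where "D k = {i \<in> {1..k}. \<pi> i < i}" for k
  have height: "height (type_word N \<pi>) k = int (card (E k)) - int (card (D k))" if "k \<le> N" for k
  proof -
    have "{i \<in> {1..k}. type_word N \<pi> ! (i - 1) = s} = {i \<in> {1..k}. step_type i (\<pi> i) = s}" for s
      using that by auto
    with that show ?thesis
      by (simp add: height_eq_card E_def D_def)
  qed
  have inj: "inj_on \<pi> A" for A
    by (simp add: inj_on_def inv(4))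
  have fin: "finite (E k)" "finite (D k)" for k
    by (simp_all add: E_def D_def)
  have pos: "0 < \<pi> i" if "0 < i" for i
    using inv(4)[of i 0] inv(2)[of 0] that by simp
  have "\<pi> ` D k \<subseteq> E k" for k
    using pos by (auto simp: D_def E_def inv(1) Suc_le_eq)
  then have le: "card (D k) \<le> card (E k)" for k
    using card_inj_on_le[OF inj _ fin(1)] by blast
  have "\<pi> ` E N \<subseteq> D N"
    using inv(3) by (fastforce simp: D_def E_def inv(1))
  then have "card (E N) \<le> card (D N)"
    using card_inj_on_le[OF inj _ fin(2)] by blast
  with le[of N] have "height (type_word N \<pi>) N = 0"
    by (simp add: height)
  moreover have "height (type_word N \<pi>) k \<ge> 0" if "k \<le> N" for k
    using le[of k] that by (simp add: height)
  ultimately show ?thesis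
    by (simp add: motzkin_paths_def)
qed

lemma strict_mono_on_same_image_unique:
  fixes f g :: "nat \<Rightarrow> nat"
  assumes "finite A" "strict_mono_on A f" "strict_mono_on A g" "f ` A = g ` A" "x \<in> A"
  shows "f x = g x"
proof -
  let ?xs = "sorted_list_of_set A"
  have "sorted (map h ?xs)" "distinct (map h ?xs)" if "strict_mono_on A h" for h :: "nat \<Rightarrow> nat"
  proof -
    have "sorted_wrt (<) (map h ?xs)"
      unfolding sorted_wrt_map
      by (rule sorted_wrt_mono_rel[OF _ strict_sorted_list_of_set])
        (use that assms(1) in \<open>auto dest: strict_mono_onD\<close>)
    then show "sorted (map h ?xs)" "distinct (map h ?xs)"
      by (auto simp: strict_sorted_iff)
  qed
  then have "map f ?xs = map g ?xs"
    using assms by (intro sorted_distinct_set_unique) auto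
  with assms show ?thesis
    by (simp add: map_eq_conv)
qed

lemma ex_strict_mono_bij_betw:
  fixes A B :: "nat set"
  assumes "finite A" "finite B" "card A = card B"
  obtains f where "bij_betw f A B" "strict_mono_on A f"
proof
  let ?e = "enumerate A" and ?I = "{..<card A}"
  let ?f = "enumerate B \<circ> inv_into ?I ?e"
  have bij: "bij_betw ?e ?I A" "bij_betw (enumerate B) ?I B"
    using assms finite_bij_enumerate[of A] finite_bij_enumerate[of B] by simp_all
  show "bij_betw ?f A B"
    using bij by (intro bij_betw_trans[OF bij_betw_inv_into])
  show "strict_mono_on A ?f"
  proof (rule strict_mono_onI)
    fix x y assume xy: "x \<in> A" "y \<in> A" "x < y"
    then obtain k l where kl: "k < card A" "l < card A" "x = ?e k" "y = ?e l"
      using bij_betw_imp_surj_on[OF bij(1)] by (metis imageE lessThan_iff)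
    then have "inv_into ?I ?e x = k" "inv_into ?I ?e y = l"
      using bij(1) by (auto simp: bij_betw_def inv_into_f_f)
    moreover have "k < l"
      using xy(3) kl assms by simp
    ultimately show "?f x < ?f y"
      using assms kl by (simp add: finite_enumerate_mono)
  qed
qed

text \<open>Nonnesting makes \<open>\<pi>\<close> increasing on the openers. It is thus the unique
  increasing map from the openers onto the closers, and the word shows both sets.\<close>

lemma type_word_inj:
  "inj_on (type_word N) {\<pi> \<in> involutions N. nonnesting \<pi>}"
proof (rule inj_onI)
  fix \<pi> \<sigma>
  assume "\<pi> \<in> {\<pi> \<in> involutions N. nonnesting \<pi>}" "\<sigma> \<in> {\<pi> \<in> involutions N. nonnesting \<pi>}"
    and word: "type_word N \<pi> = type_word N \<sigma>"
  then have \<pi>: "\<pi> \<in> involutions N" "nonnesting \<pi>" and \<sigma>: "\<sigma> \<in> involutions N" "nonnesting \<sigma>"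
    by auto
  have type: "step_type i (\<pi> i) = step_type i (\<sigma> i)" for i
  proof (cases "i \<in> {1..N}")
    case True
    then show ?thesis
      using nth_type_word[of "i - 1" N \<pi>] nth_type_word[of "i - 1" N \<sigma>] word by auto
  next
    case False
    then show ?thesis
      using involutionsD(2)[OF \<pi>(1)] involutionsD(2)[OF \<sigma>(1)] by simp
  qed
  define E where "E = {i. i < \<pi> i}"
  define D where "D = {i. \<pi> i < i}"
  have E: "E = {i. i < \<sigma> i}" and D: "D = {i. \<sigma> i < i}"
    using type step_type_eq_iff(1,2) unfolding E_def D_def by (metis, metis)
  have "E \<subseteq> {1..N}"
    using involutionsD(2)[OF \<pi>(1)] unfolding E_def by (metis less_irrefl mem_Collect_eq subsetI)
  then have fin: "finite E"
    using finite_subset by blast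
  have mono: "strict_mono_on E \<tau>" if "\<tau> \<in> involutions N" "nonnesting \<tau>" "E = {i. i < \<tau> i}" for \<tau>
  proof (rule strict_mono_onI)
    fix x y assume "x \<in> E" "y \<in> E" "x < y"
    then show "\<tau> x < \<tau> y"
      using nonnestingD[OF that(2), of x y] involutionsD(4)[OF that(1), of x y] that(3) by auto
  qed
  have image: "\<tau> ` E = D" if "\<tau> \<in> involutions N" "E = {i. i < \<tau> i}" "D = {i. \<tau> i < i}" for \<tau>
  proof (intro equalityI subsetI)
    fix x assume "x \<in> D"
    then have "\<tau> x \<in> E" "x = \<tau> (\<tau> x)"
      using that by (auto simp: involutionsD(1)[OF that(1)])
    then show "x \<in> \<tau> ` E" by blast
  qed (use that in \<open>auto simp: involutionsD(1)[OF that(1)]\<close>)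
  have on_E: "\<pi> x = \<sigma> x" if "x \<in> E" for x
    using strict_mono_on_same_image_unique[OF fin mono[OF \<pi> E_def] mono[OF \<sigma> E] _ that]
      image[OF \<pi>(1) E_def D_def] image[OF \<sigma>(1) E D] by simp
  show "\<pi> = \<sigma>"
  proof
    fix x
    consider "x \<in> E" | "x \<in> D" | "\<pi> x = x"
      unfolding E_def D_def by force
    then show "\<pi> x = \<sigma> x"
    proof cases
      case 2
      then have "\<pi> x \<in> E"
        by (simp add: D_def E_def involutionsD(1)[OF \<pi>(1)])
      from on_E[OF this] have "\<sigma> x = \<sigma> (\<sigma> (\<pi> x))"
        by (simp add: involutionsD(1)[OF \<pi>(1)])
      then show ?thesis
        by (simp add: involutionsD(1)[OF \<sigma>(1)])
    next
      case 3
      with type[of x] show ?thesis by (metis step_type_eq_iff(3))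
    qed (rule on_E)
  qed
qed

lemma type_word_surj:
  assumes p: "p \<in> motzkin_paths N"
  obtains \<pi> where "\<pi> \<in> involutions N" "nonnesting \<pi>" "type_word N \<pi> = p"
proof -
  have len: "length p = N" and nonneg: "\<And>k. k \<le> N \<Longrightarrow> height p k \<ge> 0" and zero: "height p N = 0"
    using p by (auto simp: motzkin_paths_def)
  define E where "E = {i \<in> {1..N}. p ! (i - 1) = Up}"
  define D where "D = {i \<in> {1..N}. p ! (i - 1) = Down}"
  have fin: "finite E" "finite D" and disj: "E \<inter> D = {}" and sub: "E \<subseteq> {1..N}" "D \<subseteq> {1..N}"
    by (auto simp: E_def D_def)
  have height: "height p k = int (card (E \<inter> {..k})) - int (card (D \<inter> {..k}))" if "k \<le> N" for k
  proof -
    have "{i \<in> {1..k}. p ! (i - 1) = Up} = E \<inter> {..k}" "{i \<in> {1..k}. p ! (i - 1) = Down} = D \<inter> {..k}"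
      using that by (auto simp: E_def D_def)
    with that show ?thesis
      by (simp add: height_eq_card len)
  qed
  have "E \<inter> {..N} = E" "D \<inter> {..N} = D"
    using sub by auto
  then have "card E = card D"
    using height[of N] zero by simp
  \<comment> \<open>The k-th \<open>Up\<close> is joined to the k-th \<open>Down\<close>. Joining it
    to the \<open>Down\<close> that closes it as a bracket would produce nested cycles.\<close>
  then obtain f where bij: "bij_betw f E D" and mono: "strict_mono_on E f"
    using ex_strict_mono_bij_betw fin by blast
  have fD: "f e \<in> D" if "e \<in> E" for e
    using bij that by (auto simp: bij_betw_def)
  have less: "e < f e" if e: "e \<in> E" for e
  proof (rule ccontr)
    assume "\<not> e < f e"
    moreover have "f e \<noteq> e"
      using fD[OF e] disj e by auto
    ultimately have lt: "f e < e" by simp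
    \<comment> \<open>If \<open>f e < e\<close>, then \<open>f\<close> maps the openers up to
      \<open>e\<close>, of which there are more than up to \<open>f e\<close>, to closers up to
      \<open>f e\<close>, and the path is below the axis at \<open>f e\<close>.\<close>
    have "E \<inter> {..f e} \<subset> E \<inter> {..e}"
    proof (rule psubsetI)
      have "e \<in> E \<inter> {..e}" "e \<notin> E \<inter> {..f e}"
        using lt e by auto
      then show "E \<inter> {..f e} \<noteq> E \<inter> {..e}" by blast
    qed (use lt in auto)
    then have "card (E \<inter> {..f e}) < card (E \<inter> {..e})"
      using fin by (intro psubset_card_mono) auto
    also have "\<dots> = card (f ` (E \<inter> {..e}))"
      using bij by (intro card_image[symmetric]) (auto simp: bij_betw_def inj_on_def)
    also have "\<dots> \<le> card (D \<inter> {..f e})"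
    proof (rule card_mono)
      have "f x \<le> f e" if "x \<in> E" "x \<le> e" for x
        using strict_mono_onD[OF mono, of x e] that e by (cases "x = e") auto
      then show "f ` (E \<inter> {..e}) \<subseteq> D \<inter> {..f e}"
        using fD by auto
    qed (use fin in auto)
    also have "\<dots> \<le> card (E \<inter> {..f e})"
      using nonneg[of "f e"] height[of "f e"] fD[OF e] sub by auto
    finally show False by simp
  qed
  define g where "g = inv_into E f"
  have gE: "g d \<in> E" "f (g d) = d" if "d \<in> D" for d
    using bij that unfolding g_def by (auto simp: bij_betw_def inv_into_into f_inv_into_f)
  have gf: "g (f e) = e" if "e \<in> E" for e
    using bij that unfolding g_def by (auto simp: bij_betw_def inv_into_f_f)
  define \<pi> where "\<pi> i = (if i \<in> E then f i else if i \<in> D then g i else i)" for i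
  have \<pi>_simps: "\<pi> i = f i" if "i \<in> E" for i
    using that by (simp add: \<pi>_def)
  have \<pi>_simps': "\<pi> i = g i" if "i \<in> D" for i
    using that disj by (auto simp: \<pi>_def)
  have "\<pi> (\<pi> i) = i" for i
  proof -
    consider "i \<in> E" | "i \<in> D" | "i \<notin> E \<union> D" by blast
    then show ?thesis
      by cases (auto simp: \<pi>_simps \<pi>_simps' fD gf gE, simp add: \<pi>_def)
  qed
  moreover have "\<pi> i = i" if "i \<notin> {1..N}" for i
    using that sub by (auto simp: \<pi>_def)
  ultimately have "\<pi> \<in> involutions N"
    by (simp add: involutions_def)
  moreover have type: "step_type i (\<pi> i) = (if i \<in> E then Up else if i \<in> D then Down else Horizontal)" for i
  proof -
    have "\<pi> i < i" if "i \<in> D"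
      using less[of "g i"] gE[OF that] \<pi>_simps'[OF that] by simp
    moreover have "i < \<pi> i" if "i \<in> E"
      using less[OF that] \<pi>_simps[OF that] by simp
    moreover have "\<pi> i = i" if "i \<notin> E" "i \<notin> D"
      using that by (simp add: \<pi>_def)
    ultimately show ?thesis
      using disj by (cases "i \<in> E"; cases "i \<in> D") (auto simp: step_type_def)
  qed
  moreover have "nonnesting \<pi>"
    unfolding nonnesting_def
  proof (safe, goal_cases)
    case (1 i j)
    then have "step_type i (\<pi> i) = Up" "step_type j (\<pi> j) = Up"
      by auto
    then have "i \<in> E" "j \<in> E"
      by (auto simp: type split: if_splits)
    with 1 strict_mono_onD[OF mono, of i j] show False
      by (simp add: \<pi>_simps)
  qed
  moreover have "type_word N \<pi> = p"
  proof (rule nth_equalityI)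
    fix i assume "i < length (type_word N \<pi>)"
    then show "type_word N \<pi> ! i = p ! i"
      by (cases "p ! i") (auto simp: type E_def D_def)
  qed (simp add: len)
  ultimately show thesis using that by blast
qed

lemma bij_betw_type_word:
  "bij_betw (type_word N) {\<pi> \<in> involutions N. nonnesting \<pi>} (motzkin_paths N)"
  unfolding bij_betw_def
proof (intro conjI type_word_inj equalityI subsetI)
  fix p assume "p \<in> motzkin_paths N"
  then show "p \<in> type_word N ` {\<pi> \<in> involutions N. nonnesting \<pi>}"
    by (rule type_word_surj) auto
qed (auto intro: type_word_in_motzkin_paths)

lemma card_Collect_bij_betw:
  assumes "bij_betw f A B" "\<And>x. x \<in> A \<Longrightarrow> P x \<longleftrightarrow> Q (f x)"
  shows "card {x \<in> A. P x} = card {y \<in> B. Q y}"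
proof -
  have "bij_betw f {x \<in> A. P x} {y \<in> B. Q y}"
    using assms by (auto simp: bij_betw_def inj_on_def)
  then show ?thesis by (rule bij_betw_same_card)
qed

lemma all_positions_iff: "(\<forall>i\<in>{1..<n}. P i) \<longleftrightarrow> (\<forall>i. Suc i < n \<longrightarrow> P (Suc i))"
proof (intro iffI allI impI ballI)
  fix i assume "\<forall>i. Suc i < n \<longrightarrow> P (Suc i)" "i \<in> {1..<n}"
  then show "P i" by (cases i) auto
qed auto

text \<open>Descents correspond to increases of letters, so \<open>up = True\<close> is the reverse
  alternating case. Words are indexed from 0 and positions from 1, which turns \<open>even\<close>
  into \<open>odd\<close>.\<close>

lemma card_avoiding_4321:
  "card {\<pi> \<in> involutions N. (\<forall>i\<in>{1..<N}. \<pi> i > \<pi> (i + 1) \<longleftrightarrow> (odd i \<longleftrightarrow> up)) \<and> avoids N \<pi> [4, 3, 2, 1]}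
    = card {q. length q = N \<and> motzkin_from 0 q \<and> zigzag up q}"
proof -
  have "(\<forall>i\<in>{1..<N}. \<pi> i > \<pi> (i + 1) \<longleftrightarrow> (odd i \<longleftrightarrow> up)) \<longleftrightarrow> zigzag up (type_word N \<pi>)"
    if "\<pi> \<in> {\<pi> \<in> involutions N. nonnesting \<pi>}" for \<pi>
    using that nonnesting_descent_iff[of \<pi> N] unfolding all_positions_iff zigzag_iff_nth by simp
  then have "card {\<pi> \<in> {\<pi> \<in> involutions N. nonnesting \<pi>}. \<forall>i\<in>{1..<N}. \<pi> i > \<pi> (i + 1) \<longleftrightarrow> (odd i \<longleftrightarrow> up)}
      = card {q \<in> motzkin_paths N. zigzag up q}"
    by (rule card_Collect_bij_betw[OF bij_betw_type_word])
  moreover have "{\<pi> \<in> {\<pi> \<in> involutions N. nonnesting \<pi>}. \<forall>i\<in>{1..<N}. \<pi> i > \<pi> (i + 1) \<longleftrightarrow> (odd i \<longleftrightarrow> up)}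
      = {\<pi> \<in> involutions N. (\<forall>i\<in>{1..<N}. \<pi> i > \<pi> (i + 1) \<longleftrightarrow> (odd i \<longleftrightarrow> up)) \<and> avoids N \<pi> [4, 3, 2, 1]}"
    using avoids_4321_iff_nonnesting[of _ N] by blast
  moreover have "{q \<in> motzkin_paths N. zigzag up q} = {q. length q = N \<and> motzkin_from 0 q \<and> zigzag up q}"
    by (auto simp: motzkin_paths_eq)
  ultimately show ?thesis by simp
qed

subsection \<open>Edge labels of growth diagrams\<close>

text \<open>Fomin's local rule. \<open>x\<close> tells whether the cell contains a point of the
  permutation. Equal positive labels mean that both neighbouring shapes add the same box to the
  lower left one; the next box then goes to the next row.\<close>

definition grow :: "bool \<Rightarrow> nat \<Rightarrow> nat \<Rightarrow> nat \<times> nat" where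
  "grow x a b = (if x then (1, 1) else if a = b \<and> a > 0 then (Suc a, Suc a) else (a, b))"

definition shrink :: "nat \<times> nat \<Rightarrow> nat \<times> nat" where
  "shrink ab = (if fst ab = snd ab then (fst ab - 1, snd ab - 1) else ab)"

text \<open>Truncated subtraction sends both \<open>(0, 0)\<close> and \<open>(1, 1)\<close> to
  \<open>(0, 0)\<close>. The flag separates them: a pair of labels 1 comes from a point, as equal
  positive labels grow to at least 2.\<close>

lemma grow_shrink: "grow (ab = (1, 1)) (fst (shrink ab)) (snd (shrink ab)) = ab"
  by (cases ab) (auto simp: shrink_def grow_def)

lemma grow_swap: "grow x b a = prod.swap (grow x a b)"
  by (auto simp: grow_def)

definition occ :: "(nat \<Rightarrow> nat) \<Rightarrow> nat \<Rightarrow> nat \<Rightarrow> nat" where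
  "occ w j r = card {i \<in> {1..j}. w i = r}"

lemma occ_0 [simp]: "occ w 0 r = 0"
  by (simp add: occ_def)

lemma occ_Suc: "occ w (Suc j) r = occ w j r + of_bool (w (Suc j) = r)"
  unfolding occ_def card_filter_Suc by simp

lemma occ_mono: "j \<le> k \<Longrightarrow> occ w j r \<le> occ w k r"
  by (auto simp: occ_def intro!: card_mono)

lemma occ_pos_iff: "0 < occ w j r \<longleftrightarrow> (\<exists>i\<in>{1..j}. w i = r)"
  by (auto simp: occ_def card_gt_0_iff)

lemma occ_cong: "(\<And>i. i \<in> {1..j} \<Longrightarrow> w i = v i) \<Longrightarrow> occ w j r = occ v j r"
  unfolding occ_def by (rule arg_cong[where f = card]) auto

definition ballot :: "nat \<Rightarrow> (nat \<Rightarrow> nat) \<Rightarrow> bool" where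
  "ballot N w \<longleftrightarrow> (\<forall>j. 0 < w j \<longleftrightarrow> j \<in> {1..N}) \<and> (\<forall>j\<le>N. \<forall>r>0. occ w j (Suc r) \<le> occ w j r)"

lemma ballot_posD: "ballot N w \<Longrightarrow> j \<in> {1..N} \<Longrightarrow> 0 < w j"
  unfolding ballot_def by blast

lemma ballot_zeroD: "ballot N w \<Longrightarrow> j \<notin> {1..N} \<Longrightarrow> w j = 0"
  unfolding ballot_def by blast

text \<open>Fomin's growth diagram of the Robinson-Schensted correspondence in Viennot's edge labelling. The
  horizontal edge above cell \<open>(i, j)\<close> (row \<open>i\<close>, column \<open>j\<close>) carries \<open>H i j\<close> and the vertical edge to
  its right carries \<open>V i j\<close>: the row of the box by which the shapes at the two ends of the edge
  differ, or \<open>0\<close> if these are equal.\<close>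

locale growth =
  fixes N :: nat and \<pi> :: "nat \<Rightarrow> nat" and H V :: "nat \<Rightarrow> nat \<Rightarrow> nat"
  assumes invol: "\<pi> \<in> involutions N"
    and cell: "\<And>i j. i < N \<Longrightarrow> j < N \<Longrightarrow>
      (H (Suc i) (Suc j), V (Suc i) (Suc j)) = grow (\<pi> (Suc j) = Suc i) (H i (Suc j)) (V (Suc i) j)"
    and H_bottom: "\<And>j. j < N \<Longrightarrow> H 0 (Suc j) = 0"
    and V_left: "\<And>i. i < N \<Longrightarrow> V (Suc i) 0 = 0"
begin

lemma \<pi>_pos: "j < N \<Longrightarrow> 0 < \<pi> (Suc j)"
  using involutionsD(3)[OF invol, of "Suc j"] by auto

lemma \<pi>_swap: "\<pi> j = i \<longleftrightarrow> \<pi> i = j"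
  using involutionsD(1)[OF invol] by metis

lemma H_pos_iff: "i \<le> N \<Longrightarrow> j < N \<Longrightarrow> 0 < H i (Suc j) \<longleftrightarrow> \<pi> (Suc j) \<le> i"
proof (induction i)
  case 0
  then show ?case using \<pi>_pos H_bottom by auto
next
  case (Suc i)
  then show ?case
    using cell[of i j] by (auto simp: grow_def split: if_splits)
qed

lemma V_pos_iff: "i < N \<Longrightarrow> j \<le> N \<Longrightarrow> 0 < V (Suc i) j \<longleftrightarrow> \<pi> (Suc i) \<le> j"
proof (induction j)
  case 0
  then show ?case using \<pi>_pos V_left by auto
next
  case (Suc j)
  then show ?case
    using cell[of i j] \<pi>_swap[of "Suc j" "Suc i"] by (auto simp: grow_def split: if_splits)
qed

lemma cell_cases:
  assumes "i < N" "j < N"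
  obtains (cross) "\<pi> (Suc j) = Suc i" "H i (Suc j) = 0" "V (Suc i) j = 0"
      "H (Suc i) (Suc j) = 1" "V (Suc i) (Suc j) = 1"
    | (bump) a where "\<pi> (Suc j) \<noteq> Suc i" "0 < a" "H i (Suc j) = a" "V (Suc i) j = a"
      "H (Suc i) (Suc j) = Suc a" "V (Suc i) (Suc j) = Suc a"
    | (pass) "\<pi> (Suc j) \<noteq> Suc i" "H i (Suc j) \<noteq> V (Suc i) j \<or> H i (Suc j) = 0 \<and> V (Suc i) j = 0"
      "H (Suc i) (Suc j) = H i (Suc j)" "V (Suc i) (Suc j) = V (Suc i) j"
proof -
  have "H i (Suc j) = 0 \<and> V (Suc i) j = 0" if "\<pi> (Suc j) = Suc i"
    using H_pos_iff[of i j] V_pos_iff[of i j] \<pi>_swap[of "Suc j" "Suc i"] that assms by auto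
  then show thesis
    using cell[OF assms] that by (auto simp: grow_def split: if_splits)
qed

lemma shrink_cell:
  "i < N \<Longrightarrow> j < N \<Longrightarrow> (H i (Suc j), V (Suc i) j) = shrink (H (Suc i) (Suc j), V (Suc i) (Suc j))"
  by (erule (1) cell_cases) (auto simp: shrink_def)

lemma cross_iff: "i < N \<Longrightarrow> j < N \<Longrightarrow> \<pi> (Suc j) = Suc i \<longleftrightarrow> H (Suc i) (Suc j) = 1 \<and> V (Suc i) (Suc j) = 1"
  by (erule (1) cell_cases) auto

lemma V_eq_H_transpose: "i \<le> N \<Longrightarrow> j \<le> N \<Longrightarrow> (0 < j \<longrightarrow> H i j = V j i) \<and> (0 < i \<longrightarrow> V i j = H j i)"
proof (induction "i + j" arbitrary: i j rule: less_induct)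
  case less
  show ?case
  proof (cases i; cases j)
    fix i' j' assume ij: "i = Suc i'" "j = Suc j'"
    have "H i' j = V j i'" "V i j' = H j' i"
      using less.hyps[of i' j] less.hyps[of i j'] less.prems ij by auto
    then have "(H i j, V i j) = prod.swap (H j i, V j i)"
      using cell[of i' j'] cell[of j' i'] less.prems ij \<pi>_swap[of i j] grow_swap[of "\<pi> i = j" "H j' i" "V j i'"]
      by simp
    then show ?thesis by simp
  qed (use less.prems H_bottom V_left in \<open>auto simp: Suc_le_eq\<close>)
qed

text \<open>\<open>occ (H i) j r\<close> is the length of row \<open>r\<close> of the shape at the
  corner \<open>(i, j)\<close>, read along the horizontal edges from the empty left border. The
  vertical labels describe the same shapes.\<close>

lemma occ_H_Suc: "i < N \<Longrightarrow> j \<le> N \<Longrightarrow> 0 < r \<Longrightarrow> occ (H (Suc i)) j r = occ (H i) j r + of_bool (V (Suc i) j = r)"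
proof (induction j)
  case 0
  then show ?case by (simp add: V_left)
next
  case (Suc j)
  then have "j < N" by simp
  with Suc show ?case
    by (cases rule: cell_cases[OF \<open>i < N\<close> \<open>j < N\<close>]) (auto simp: occ_Suc)
qed

lemma occ_H_bottom: "j \<le> N \<Longrightarrow> 0 < r \<Longrightarrow> occ (H 0) j r = 0"
  by (induction j) (auto simp: occ_Suc H_bottom)

text \<open>Shapes are partitions. A bump is the delicate case: rows \<open>a\<close> and
  \<open>Suc a\<close> both gain a box over the lower left shape, so their order is inherited from
  that shape, the third induction hypothesis.\<close>

lemma occ_H_decreasing: "i \<le> N \<Longrightarrow> j \<le> N \<Longrightarrow> 0 < r \<Longrightarrow> occ (H i) j (Suc r) \<le> occ (H i) j r"
proof (induction "i + j" arbitrary: i j r rule: less_induct)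
  case less
  show ?case
  proof (cases i; cases j)
    fix i' j' assume ij: "i = Suc i'" "j = Suc j'"
    with less.prems have lt: "i' < N" "j' < N" by auto
    have IH: "occ (H i') j (Suc r) \<le> occ (H i') j r" "occ (H i) j' (Suc r) \<le> occ (H i) j' r"
      "occ (H i') j' (Suc r) \<le> occ (H i') j' r"
      using less.hyps[of i' j r] less.hyps[of i j' r] less.hyps[of i' j' r] less.prems ij by auto
    show ?thesis
      using lt
    proof (cases rule: cell_cases)
      case cross
      with IH show ?thesis
        using less.prems ij occ_H_Suc[OF lt(1), of j] lt by (auto simp: occ_Suc)
    next
      case (bump a)
      with IH show ?thesis
        using less.prems ij occ_H_Suc[OF lt(1), of j'] occ_H_Suc[OF lt(1), of j] lt by (auto simp: occ_Suc of_bool_def)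
    next
      case pass
      with IH show ?thesis
        using less.prems ij occ_H_Suc[OF lt(1), of j'] occ_H_Suc[OF lt(1), of j] lt
        by (auto simp: occ_Suc of_bool_def split: if_splits)
    qed
  qed (use less.prems occ_H_bottom in auto)
qed

text \<open>Row bumping lemma for edge labels. If the left cell bumps, the vertical label leaves it
  larger than the right label, which then stays; otherwise a bump on the right starts strictly below
  the left label.\<close>

lemma H_ascent:
  assumes "Suc j < N" "\<pi> (Suc j) < \<pi> (Suc (Suc j))"
  shows "i \<le> N \<Longrightarrow> H i (Suc (Suc j)) \<le> H i (Suc j)"
proof (induction i)
  case 0
  then show ?case using assms H_bottom by simp
next
  case (Suc i)
  then have IH: "H i (Suc (Suc j)) \<le> H i (Suc j)" and i: "i < N" by auto
  have j: "j < N" using assms(1) by simp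
  have "0 < H i (Suc j)" if "\<pi> (Suc (Suc j)) = Suc i"
    using H_pos_iff[of i j] that assms i by simp
  then show ?case
    using IH by (cases rule: cell_cases[OF i j]; cases rule: cell_cases[OF i assms(1)]) auto
qed

text \<open>A bump to \<open>Suc a\<close> on the left passes \<open>Suc a\<close> on, so a right
  label equal to it is bumped in turn and the inequality stays strict. The right label is 0 until
  the point of its column is reached.\<close>

lemma H_descent:
  assumes "Suc j < N" "\<pi> (Suc (Suc j)) < \<pi> (Suc j)"
  shows "i \<le> N \<Longrightarrow> H i (Suc (Suc j)) = 0 \<or> H i (Suc j) < H i (Suc (Suc j))"
proof (induction i)
  case 0
  then show ?case using assms H_bottom by simp
next
  case (Suc i)
  then have IH: "H i (Suc (Suc j)) = 0 \<or> H i (Suc j) < H i (Suc (Suc j))" and i: "i < N" by auto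
  have j: "j < N" using assms(1) by simp
  have "0 < H i (Suc (Suc j))" if "\<pi> (Suc j) = Suc i"
    using H_pos_iff[of i "Suc j"] that assms i by simp
  moreover have "H (Suc i) (Suc j) = 0" if "\<pi> (Suc (Suc j)) = Suc i"
    using H_pos_iff[of "Suc i" j] that assms i by simp
  ultimately show ?case
    using IH by (cases rule: cell_cases[OF i j]; cases rule: cell_cases[OF i assms(1)]) auto
qed

lemma top_ascent_iff:
  assumes "Suc j < N"
  shows "\<pi> (Suc j) < \<pi> (Suc (Suc j)) \<longleftrightarrow> H N (Suc (Suc j)) \<le> H N (Suc j)"
proof -
  have "\<pi> (Suc j) \<noteq> \<pi> (Suc (Suc j))"
    by (simp add: involutionsD(4)[OF invol])
  moreover have "0 < H N (Suc (Suc j))"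
    using H_pos_iff[of N "Suc j"] involutionsD(3)[OF invol, of "Suc (Suc j)"] assms by simp
  ultimately show ?thesis
    using H_ascent[OF assms, of N] H_descent[OF assms, of N] by fastforce
qed

end

section \<open>First row and increasing subsequences\<close>

fun increasing_chain :: "(nat \<Rightarrow> nat) \<Rightarrow> nat \<Rightarrow> nat \<Rightarrow> nat \<Rightarrow> bool" where
  "increasing_chain \<pi> 0 i j \<longleftrightarrow> True"
| "increasing_chain \<pi> (Suc k) i j \<longleftrightarrow> (\<exists>l\<in>{1..j}. \<pi> l \<le> i \<and> increasing_chain \<pi> k (\<pi> l - 1) (l - 1))"

lemma increasing_chain_Suc_Suc:
  "increasing_chain \<pi> (Suc k) (Suc i) (Suc j) \<longleftrightarrow>
     increasing_chain \<pi> (Suc k) i (Suc j) \<or> increasing_chain \<pi> (Suc k) (Suc i) j \<or>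
     \<pi> (Suc j) = Suc i \<and> increasing_chain \<pi> k i j"
  by (fastforce simp: le_Suc_eq)

text \<open>Schensted's theorem in every rectangle at the lower left corner. The first row satisfies
  the recursion \<open>increasing_chain_Suc_Suc\<close>: a point lengthens it by one box, and in the
  other cells it is the longer of the first rows of the two neighbours. Comparison with all
  \<open>k\<close> replaces a maximum.\<close>

lemma (in growth) le_occ_1_iff:
  "i \<le> N \<Longrightarrow> j \<le> N \<Longrightarrow> k \<le> occ (H i) j 1 \<longleftrightarrow> increasing_chain \<pi> k i j"
proof (induction "i + j" arbitrary: i j k rule: less_induct)
  case less
  show ?case
  proof (cases k)
    case k: (Suc k')
    show ?thesis
    proof (cases "i = 0 \<or> j = 0")
      case False
      then obtain i' j' where ij: "i = Suc i'" "j = Suc j'"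
        by (auto simp: gr0_conv_Suc)
      with less.prems have lt: "i' < N" "j' < N" by auto
      have IH: "k \<le> occ (H i') j 1 \<longleftrightarrow> increasing_chain \<pi> k i' j" "k \<le> occ (H i) j' 1 \<longleftrightarrow> increasing_chain \<pi> k i j'"
        "k' \<le> occ (H i') j' 1 \<longleftrightarrow> increasing_chain \<pi> k' i' j'"
        using less.hyps[of i' j k] less.hyps[of i j' k] less.hyps[of i' j' k'] less.prems ij by auto
      have "k \<le> occ (H i) j 1 \<longleftrightarrow>
          k \<le> occ (H i') j 1 \<or> k \<le> occ (H i) j' 1 \<or> \<pi> j = i \<and> k' \<le> occ (H i') j' 1"
        using occ_H_Suc[OF lt(1), of j' 1] occ_H_Suc[OF lt(1), of j 1] lt
        by (cases rule: cell_cases[OF lt]) (auto simp: ij k occ_Suc of_bool_def split: if_splits)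
      then show ?thesis
        unfolding IH unfolding ij k increasing_chain_Suc_Suc .
    next
      case True
      moreover have "0 < \<pi> l" if "l \<in> {1..j}" for l
        using \<pi>_pos[of "l - 1"] that less.prems by auto
      ultimately have "\<not> increasing_chain \<pi> k i j"
        unfolding k increasing_chain.simps by fastforce
      then show ?thesis
        using occ_H_bottom[of j 1] less.prems k True by auto
    qed
  qed simp
qed

lemma increasing_chain_4_iff:
  assumes "\<pi> \<in> involutions N"
  shows "increasing_chain \<pi> 4 N N \<longleftrightarrow> \<not> avoids N \<pi> [1, 2, 3, 4]"
proof -
  have pos: "0 < \<pi> i" if "0 < i" for i
    using involutionsD(4)[OF assms, of i 0] involutionsD(2)[OF assms, of 0] that by simp
  \<comment> \<open>Positive values keep \<open>\<pi> i - 1\<close> from being truncated, so the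
    smaller box expresses strict inequalities.\<close>
  have less: "l \<in> {1..i - 1} \<and> \<pi> l \<le> \<pi> i - 1 \<longleftrightarrow> 1 \<le> l \<and> l < i \<and> \<pi> l < \<pi> i" if "0 < i" for i l
    using pos[OF that] by auto
  have step: "increasing_chain \<pi> (Suc k) (\<pi> i - 1) (i - 1) \<longleftrightarrow>
      (\<exists>l. 1 \<le> l \<and> l < i \<and> \<pi> l < \<pi> i \<and> increasing_chain \<pi> k (\<pi> l - 1) (l - 1))" if "0 < i" for k i
    unfolding increasing_chain.simps Bex_def using less[OF that] by blast
  have top: "l \<in> {1..N} \<and> \<pi> l \<le> N \<longleftrightarrow> 1 \<le> l \<and> l \<le> N" for l
    using involutionsD(3)[OF assms, of l] by auto
  have 1: "increasing_chain \<pi> (Suc 0) (\<pi> i - 1) (i - 1) \<longleftrightarrow> (\<exists>a. 1 \<le> a \<and> a < i \<and> \<pi> a < \<pi> i)"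
    if "0 < i" for i
    unfolding step[OF that] by simp
  have 2: "increasing_chain \<pi> (Suc (Suc 0)) (\<pi> i - 1) (i - 1) \<longleftrightarrow>
      (\<exists>b. 1 \<le> b \<and> b < i \<and> \<pi> b < \<pi> i \<and> (\<exists>a. 1 \<le> a \<and> a < b \<and> \<pi> a < \<pi> b))" if "0 < i" for i
    unfolding step[OF that] using 1 by (intro arg_cong[where f = Ex] ext conj_cong refl) auto
  have 3: "increasing_chain \<pi> (Suc (Suc (Suc 0))) (\<pi> i - 1) (i - 1) \<longleftrightarrow>
      (\<exists>c. 1 \<le> c \<and> c < i \<and> \<pi> c < \<pi> i \<and> (\<exists>b. 1 \<le> b \<and> b < c \<and> \<pi> b < \<pi> c \<and> (\<exists>a. 1 \<le> a \<and> a < b \<and> \<pi> a < \<pi> b)))"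
    if "0 < i" for i
    unfolding step[OF that] using 2 by (intro arg_cong[where f = Ex] ext conj_cong refl) auto
  have "increasing_chain \<pi> 4 N N \<longleftrightarrow>
      (\<exists>d. (d \<in> {1..N} \<and> \<pi> d \<le> N) \<and> increasing_chain \<pi> (Suc (Suc (Suc 0))) (\<pi> d - 1) (d - 1))"
    unfolding numeral_eq_Suc pred_numeral_simps BitM.simps increasing_chain.simps(2)[of _ "Suc (Suc (Suc 0))"] Bex_def
    by (simp only: conj_assoc)
  also have "\<dots> \<longleftrightarrow> (\<exists>d. (1 \<le> d \<and> d \<le> N) \<and> (\<exists>c. 1 \<le> c \<and> c < d \<and> \<pi> c < \<pi> d \<and>
      (\<exists>b. 1 \<le> b \<and> b < c \<and> \<pi> b < \<pi> c \<and> (\<exists>a. 1 \<le> a \<and> a < b \<and> \<pi> a < \<pi> b))))"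
    unfolding top using 3 by (intro arg_cong[where f = Ex] ext conj_cong refl) auto
  also have "\<dots> \<longleftrightarrow> \<not> avoids N \<pi> [1, 2, 3, 4]"
    unfolding avoids_1234_iff not_not
  proof (intro iffI)
    assume "\<exists>a b c d. 1 \<le> a \<and> a < b \<and> b < c \<and> c < d \<and> d \<le> N \<and> \<pi> a < \<pi> b \<and> \<pi> b < \<pi> c \<and> \<pi> c < \<pi> d"
    then obtain a b c d where
      "1 \<le> a" "a < b" "b < c" "c < d" "d \<le> N" "\<pi> a < \<pi> b" "\<pi> b < \<pi> c" "\<pi> c < \<pi> d" by blast
    moreover from this have "1 \<le> b" "1 \<le> c" "1 \<le> d" by auto
    ultimately show "\<exists>d. (1 \<le> d \<and> d \<le> N) \<and> (\<exists>c. 1 \<le> c \<and> c < d \<and> \<pi> c < \<pi> d \<and>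
      (\<exists>b. 1 \<le> b \<and> b < c \<and> \<pi> b < \<pi> c \<and> (\<exists>a. 1 \<le> a \<and> a < b \<and> \<pi> a < \<pi> b)))" by blast
  qed blast
  finally show ?thesis .
qed

section \<open>The label word of an involution\<close>

fun growth_labels :: "(nat \<Rightarrow> nat) \<Rightarrow> nat \<Rightarrow> nat \<Rightarrow> nat \<times> nat" where
  "growth_labels \<pi> 0 j = (0, 0)"
| "growth_labels \<pi> (Suc i) 0 = (0, 0)"
| "growth_labels \<pi> (Suc i) (Suc j) =
     grow (\<pi> (Suc j) = Suc i) (fst (growth_labels \<pi> i (Suc j))) (snd (growth_labels \<pi> (Suc i) j))"

lemma growth_growth_labels:
  "\<pi> \<in> involutions N \<Longrightarrow> growth N \<pi> (\<lambda>i j. fst (growth_labels \<pi> i j)) (\<lambda>i j. snd (growth_labels \<pi> i j))"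
  by unfold_locales auto

lemma growth_unique:
  assumes "growth N \<pi> H V" "growth N \<pi> H' V'"
  shows "i \<le> N \<Longrightarrow> j \<le> N \<Longrightarrow> (0 < j \<longrightarrow> H i j = H' i j) \<and> (0 < i \<longrightarrow> V i j = V' i j)"
proof (induction "i + j" arbitrary: i j rule: less_induct)
  case less
  show ?case
  proof (cases i; cases j)
    fix i' j' assume ij: "i = Suc i'" "j = Suc j'"
    have "H i' j = H' i' j" "V i j' = V' i j'"
      using less.hyps[of i' j] less.hyps[of i j'] less.prems ij by auto
    then have "(H i j, V i j) = (H' i j, V' i j)"
      using growth.cell[OF assms(1), of i' j'] growth.cell[OF assms(2), of i' j'] less.prems ij by simp
    then show ?thesis by simp
  qed (use less.prems in \<open>auto simp: Suc_le_eq growth.H_bottom[OF assms(1)] growth.H_bottom[OF assms(2)]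
        growth.V_left[OF assms(1)] growth.V_left[OF assms(2)]\<close>)
qed

text \<open>\<open>shrink\<close> computes the lower and left labels of a cell from the upper and
  right ones, and by symmetry the right border is the transposed top border.\<close>

lemma growth_determined_by_top:
  assumes G: "growth N \<pi> H V" and G': "growth N \<pi>' H' V'"
    and top: "\<And>j. j \<in> {1..N} \<Longrightarrow> H N j = H' N j"
  shows "i \<le> N \<Longrightarrow> j \<le> N \<Longrightarrow> (0 < j \<longrightarrow> H i j = H' i j) \<and> (0 < i \<longrightarrow> V i j = V' i j)"
proof (induction "(N - i) + (N - j)" arbitrary: i j rule: less_induct)
  case less
  have "H i j = H' i j" if "0 < j"
  proof (cases "i = N")
    case False
    with less.hyps[of "Suc i" j] less.prems that
    have "(H (Suc i) j, V (Suc i) j) = (H' (Suc i) j, V' (Suc i) j)" by simp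
    then show ?thesis
      using growth.shrink_cell[OF G, of i "j - 1"] growth.shrink_cell[OF G', of i "j - 1"] False less.prems that
      by (metis One_nat_def Suc_le_eq Suc_pred fst_conv le_neq_implies_less)
  qed (use top less.prems that in auto)
  moreover have "V i j = V' i j" if "0 < i"
  proof (cases "j = N")
    case True
    then show ?thesis
      using growth.V_eq_H_transpose[OF G, of i N] growth.V_eq_H_transpose[OF G', of i N] top[of i] less.prems that
      by simp
  next
    case False
    with less.hyps[of i "Suc j"] less.prems that
    have "(H i (Suc j), V i (Suc j)) = (H' i (Suc j), V' i (Suc j))" by simp
    then show ?thesis
      using growth.shrink_cell[OF G, of "i - 1" j] growth.shrink_cell[OF G', of "i - 1" j] False less.prems that
      by (metis One_nat_def Suc_le_eq Suc_pred snd_conv le_neq_implies_less)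
  qed
  ultimately show ?case by simp
qed

definition label_word :: "nat \<Rightarrow> (nat \<Rightarrow> nat) \<Rightarrow> nat \<Rightarrow> nat" where
  "label_word N \<pi> j = (if j \<in> {1..N} then fst (growth_labels \<pi> N j) else 0)"

lemma label_word_eq:
  assumes "growth N \<pi> H V" "j \<in> {1..N}"
  shows "label_word N \<pi> j = H N j"
  using growth_unique[OF assms(1) growth_growth_labels[OF growth.invol[OF assms(1)]], of N j] assms(2)
  by (simp add: label_word_def)

lemma ballot_label_word:
  assumes "\<pi> \<in> involutions N"
  shows "ballot N (label_word N \<pi>)"
proof -
  interpret growth N \<pi> "\<lambda>i j. fst (growth_labels \<pi> i j)" "\<lambda>i j. snd (growth_labels \<pi> i j)"
    using assms by (rule growth_growth_labels)
  have "0 < label_word N \<pi> j" if "j \<in> {1..N}" for j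
    using H_pos_iff[of N "j - 1"] involutionsD(3)[OF assms that] that by (auto simp: label_word_def)
  moreover have "occ (label_word N \<pi>) j r = occ (\<lambda>j. fst (growth_labels \<pi> N j)) j r" if "j \<le> N" for j r
    using that by (intro occ_cong) (simp add: label_word_def)
  moreover have "label_word N \<pi> j = 0" if "j \<notin> {1..N}" for j
    using that by (auto simp: label_word_def)
  ultimately show ?thesis
    using occ_H_decreasing[of N] unfolding ballot_def by (metis le_refl less_irrefl)
qed

lemma inj_label_word: "inj_on (label_word N) (involutions N)"
proof (rule inj_onI)
  fix \<pi> \<sigma> assume \<pi>: "\<pi> \<in> involutions N" and \<sigma>: "\<sigma> \<in> involutions N" and eq: "label_word N \<pi> = label_word N \<sigma>"
  have "growth_labels \<pi> i j = growth_labels \<sigma> i j" if "i \<in> {1..N}" "j \<in> {1..N}" for i j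
    using growth_determined_by_top[OF growth_growth_labels[OF \<pi>] growth_growth_labels[OF \<sigma>], of i j]
      label_word_eq[OF growth_growth_labels[OF \<pi>]] label_word_eq[OF growth_growth_labels[OF \<sigma>]] eq that
    by (auto simp: prod_eq_iff)
  then have "\<pi> (Suc j) = Suc i \<longleftrightarrow> \<sigma> (Suc j) = Suc i" if "i < N" "j < N" for i j
    using growth.cross_iff[OF growth_growth_labels[OF \<pi>], of i j]
      growth.cross_iff[OF growth_growth_labels[OF \<sigma>], of i j] that
    by (simp del: growth_labels.simps)
  then have cross: "\<pi> j = i \<longleftrightarrow> \<sigma> j = i" if "i \<in> {1..N}" "j \<in> {1..N}" for i j
    using that by (cases i; cases j) auto
  show "\<pi> = \<sigma>"
  proof
    fix j show "\<pi> j = \<sigma> j"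
      using involutionsD(2,3)[OF \<pi>, of j] involutionsD(2)[OF \<sigma>, of j] cross by (cases "j \<in> {1..N}") metis+
  qed
qed

text \<open>The growth diagram with top and right labels \<open>w\<close> is rebuilt from its top right corner;
  \<open>k\<close> and \<open>l\<close> count rows and columns from there.\<close>

function top_labels :: "nat \<Rightarrow> (nat \<Rightarrow> nat) \<Rightarrow> nat \<Rightarrow> nat \<Rightarrow> nat \<times> nat" where
  "top_labels N w k l =
     (if k = 0 then w (N - l) else fst (shrink (top_labels N w (k - 1) l)),
      if l = 0 then w (N - k) else snd (shrink (top_labels N w k (l - 1))))"
  by auto
termination
  by (relation "measure (\<lambda>(N, w, k, l). k + l)") auto

declare top_labels.simps [simp del]

locale reverse_growth =
  fixes N :: nat and w :: "nat \<Rightarrow> nat"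
  assumes ballot: "ballot N w"
begin

definition H :: "nat \<Rightarrow> nat \<Rightarrow> nat" where
  "H i j = fst (top_labels N w (N - i) (N - j))"

definition V :: "nat \<Rightarrow> nat \<Rightarrow> nat" where
  "V i j = snd (top_labels N w (N - i) (N - j))"

lemma H_top: "j \<le> N \<Longrightarrow> H N j = w j"
  by (simp add: H_def top_labels.simps)

lemma V_right: "i \<le> N \<Longrightarrow> V i N = w i"
  by (simp add: V_def top_labels.simps)

lemma shrink_cell:
  "i < N \<Longrightarrow> j < N \<Longrightarrow> (H i (Suc j), V (Suc i) j) = shrink (H (Suc i) (Suc j), V (Suc i) (Suc j))"
  by (subst prod_eq_iff) (simp add: H_def V_def top_labels.simps[of N w "N - i"] top_labels.simps[of N w _ "N - j"])

lemma V_eq_H_transpose: "i \<le> N \<Longrightarrow> j \<le> N \<Longrightarrow> V i j = H j i"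
proof -
  have "prod.swap (top_labels N w k l) = top_labels N w l k" for k l
  proof (induction "k + l" arbitrary: k l rule: less_induct)
    case less
    have "k > 0 \<Longrightarrow> prod.swap (top_labels N w (k - 1) l) = top_labels N w l (k - 1)"
      and "l > 0 \<Longrightarrow> prod.swap (top_labels N w k (l - 1)) = top_labels N w (l - 1) k"
      using less by auto
    moreover have "fst (shrink (prod.swap p)) = snd (shrink p)" "snd (shrink (prod.swap p)) = fst (shrink p)" for p
      by (auto simp: shrink_def)
    ultimately show ?case
      unfolding top_labels.simps[of N w k l] top_labels.simps[of N w l k] by (smt (verit) swap_simp gr0I)
  qed
  then have "snd (top_labels N w k l) = fst (top_labels N w l k)" for k l
    by (metis fst_swap)
  then show "i \<le> N \<Longrightarrow> j \<le> N \<Longrightarrow> V i j = H j i"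
    by (simp add: H_def V_def)
qed

text \<open>The shape at a corner, obtained from the top border by removing boxes on the way down.
  Integer values leave room for negative lengths until \<open>shape_partition\<close> excludes
  them.\<close>

definition shape :: "nat \<Rightarrow> nat \<Rightarrow> nat \<Rightarrow> int" where
  "shape i j r = int (occ w j r) - (\<Sum>k\<in>{i<..N}. of_bool (V k j = r))"

lemma shape_up: "i < N \<Longrightarrow> shape (Suc i) j r = shape i j r + of_bool (V (Suc i) j = r)"
proof -
  assume "i < N"
  then have "{i<..N} = insert (Suc i) {Suc i<..N}" by auto
  then show ?thesis by (simp add: shape_def)
qed

lemma shape_top: "shape N j r = int (occ w j r)"
  by (simp add: shape_def)

lemma shape_right_border: "i \<le> N \<Longrightarrow> shape i N r = int (occ w i r)"
proof (induction i rule: inc_induct)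
  case (step i)
  then show ?case
    using shape_up[of i N r] V_right[of "Suc i"] by (auto simp: occ_Suc)
qed (rule shape_top)

lemma shape_right: "i \<le> N \<Longrightarrow> j < N \<Longrightarrow> 0 < r \<Longrightarrow> shape i (Suc j) r = shape i j r + of_bool (H i (Suc j) = r)"
proof (induction i rule: inc_induct)
  case base
  then show ?case by (simp add: shape_top H_top occ_Suc)
next
  case (step i)
  then show ?case
    using shape_up[of i j r] shape_up[of i "Suc j" r] shrink_cell[of i j]
    by (auto simp: shrink_def of_bool_def split: if_splits)
qed

text \<open>For \<open>a \<noteq> b\<close> the lower left shape is the intersection of its two
  neighbours. For \<open>a = b\<close> the rows \<open>a\<close> and \<open>a - 1\<close> each lose
  a box, so their order persists, and row \<open>a\<close> can spare one because the upper left
  shape is a partition.\<close>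

lemma shape_partition:
  "i \<le> N \<Longrightarrow> j \<le> N \<Longrightarrow> 0 < r \<Longrightarrow> shape i j (Suc r) \<le> shape i j r \<and> 0 \<le> shape i j r"
proof (induction "(N - i) + (N - j)" arbitrary: i j r rule: less_induct)
  case less
  consider "i = N" | "j = N" | "i < N" "j < N"
    using less.prems by linarith
  then show ?case
  proof cases
    case 3
    have IH: "shape i' j' (Suc s) \<le> shape i' j' s \<and> 0 \<le> shape i' j' s"
      if "i' \<in> {i, Suc i}" "j' \<in> {j, Suc j}" "(i', j') \<noteq> (i, j)" "0 < s" for i' j' s
      using less.hyps[of i' j' s] that 3 by fastforce
    define a where "a = H (Suc i) (Suc j)"
    define b where "b = V (Suc i) (Suc j)"
    have up: "shape (Suc i) (Suc j) s = shape i (Suc j) s + of_bool (b = s)" for s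
      using shape_up[of i "Suc j"] 3 by (simp add: b_def)
    have right: "shape (Suc i) (Suc j) s = shape (Suc i) j s + of_bool (a = s)" if "0 < s" for s
      using shape_right[of "Suc i" j s] 3 that by (simp add: a_def)
    have corner: "shape (Suc i) j s = shape i j s + of_bool (snd (shrink (a, b)) = s)" for s
      using shape_up[of i j] shrink_cell[of i j] 3 by (metis a_def b_def snd_conv)
    show ?thesis
    proof (cases "a = b")
      case True
      then have nu: "shape i j s = shape (Suc i) (Suc j) s - of_bool (a = s) - of_bool (a - 1 = s)" if "0 < s" for s
        using right[OF that] corner[of s] by (simp add: shrink_def)
      have mu: "shape (Suc i) j s = shape (Suc i) (Suc j) s - of_bool (a = s)" if "0 < s" for s
        using right[OF that] by simp
      show ?thesis
        using IH[of "Suc i" j r] IH[of "Suc i" "Suc j" r] IH[of "Suc i" j "Suc r"] IH[of "Suc i" "Suc j" "Suc r"]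
          nu[of r] nu[of "Suc r"] mu[of r] mu[of "Suc r"] mu[of "Suc (Suc r)"] less.prems(3)
        by (auto simp: of_bool_def split: if_splits)
    next
      case False
      then have nu: "shape (Suc i) j s = shape i j s + of_bool (b = s)" for s
        using corner[of s] by (simp add: shrink_def)
      show ?thesis
        using IH[of "Suc i" j r] IH[of i "Suc j" r] IH[of "Suc i" j "Suc r"] IH[of i "Suc j" "Suc r"]
          nu[of r] nu[of "Suc r"] up[of r] up[of "Suc r"] right[of r] right[of "Suc r"] less.prems(3) False
        by (auto simp: of_bool_def split: if_splits)
    qed
  qed (use ballot less.prems in \<open>auto simp: shape_top shape_right_border ballot_def\<close>)
qed

text \<open>In column 0 nothing comes from the top border, so a positive vertical label would make a
  row length negative.\<close>

lemma V_left: "i < N \<Longrightarrow> V (Suc i) 0 = 0"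
proof (rule ccontr)
  assume i: "i < N" and pos: "V (Suc i) 0 \<noteq> 0"
  define r where "r = V (Suc i) 0"
  have "0 < (\<Sum>k\<in>{i<..N}. of_bool (V k 0 = r) :: int)"
    using i by (intro sum_pos2[of _ "Suc i"]) (auto simp: r_def)
  then have "shape i 0 r < 0"
    by (simp add: shape_def)
  then show False
    using shape_partition[of i 0 r] i pos by (simp add: r_def)
qed

definition cross :: "nat \<Rightarrow> nat \<Rightarrow> bool" where
  "cross i j \<longleftrightarrow> i \<in> {1..N} \<and> j \<in> {1..N} \<and> H i j = 1 \<and> V i j = 1"

lemma cross_swap: "cross i j \<longleftrightarrow> cross j i"
  using V_eq_H_transpose[of i j] V_eq_H_transpose[of j i] by (auto simp: cross_def)

lemma cell:
  assumes "i < N" "j < N"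
  shows "(H (Suc i) (Suc j), V (Suc i) (Suc j)) = grow (cross (Suc i) (Suc j)) (H i (Suc j)) (V (Suc i) j)"
proof -
  let ?ab = "(H (Suc i) (Suc j), V (Suc i) (Suc j))"
  have "cross (Suc i) (Suc j) \<longleftrightarrow> ?ab = (1, 1)"
    using assms by (auto simp: cross_def)
  moreover have "fst (shrink ?ab) = H i (Suc j)" "snd (shrink ?ab) = V (Suc i) j"
    using shrink_cell[OF assms] by (metis fst_conv, metis snd_conv)
  ultimately show ?thesis
    using grow_shrink[of ?ab] by simp
qed

lemma V_pos_iff: "i < N \<Longrightarrow> j \<le> N \<Longrightarrow> 0 < V (Suc i) j \<longleftrightarrow> (\<exists>l\<in>{1..j}. cross (Suc i) l)"
proof (induction j)
  case (Suc j)
  have "0 < V (Suc i) (Suc j) \<longleftrightarrow> cross (Suc i) (Suc j) \<or> 0 < V (Suc i) j"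
    using cell[of i j] Suc.prems by (auto simp: grow_def split: if_splits)
  with Suc show ?case by (auto simp: atLeastAtMostSuc_conv)
qed (simp add: V_left)

text \<open>Along a row the vertical label rises from 0 to the positive \<open>w i\<close>. It
  becomes positive only at a cross and stays positive, whereas a cross needs the incoming label
  0.\<close>

lemma ex1_cross:
  assumes "i \<in> {1..N}"
  shows "\<exists>!j. cross i j"
proof -
  obtain i' where i: "i = Suc i'" "i' < N"
    using assms by (cases i) auto
  have "0 < V i N"
    using ballot assms V_right[of i] by (simp add: ballot_def)
  then obtain j where j: "cross i j"
    using V_pos_iff[of i' N] i by auto
  have False if kl: "cross i k" "cross i l" "k < l" for k l
  proof -
    obtain l' where l: "l = Suc l'" "l' < N"
      using kl(2) by (cases l) (auto simp: cross_def)
    have "V i l' = 0"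
      using shrink_cell[of i' l'] kl i l by (auto simp: cross_def shrink_def)
    then show False
      using V_pos_iff[of i' l'] kl i l by (auto simp: cross_def)
  qed
  with j show ?thesis
    by (metis linorder_neqE_nat)
qed

definition perm :: "nat \<Rightarrow> nat" where
  "perm j = (if j \<in> {1..N} then THE i. cross j i else j)"

lemma perm_eq_iff: "j \<in> {1..N} \<Longrightarrow> perm j = i \<longleftrightarrow> cross i j"
proof -
  assume j: "j \<in> {1..N}"
  then have "perm j = (THE i. cross j i)"
    unfolding perm_def by (rule if_P)
  then show ?thesis
    using ex1_cross[OF j] cross_swap by (metis theI')
qed

lemma perm_in_involutions: "perm \<in> involutions N"
proof -
  have "perm (perm j) = j" for j
  proof (cases "j \<in> {1..N}")
    case True
    then have "cross (perm j) j"
      using perm_eq_iff by blast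
    then show ?thesis
      using perm_eq_iff[of "perm j" j] cross_swap by (auto simp: cross_def)
  next
    case False
    then have "perm j = j"
      unfolding perm_def by (rule if_not_P)
    then show ?thesis by simp
  qed
  moreover have "perm j = j" if "j \<notin> {1..N}" for j
    using that unfolding perm_def by (rule if_not_P)
  ultimately show ?thesis
    by (simp add: involutions_def)
qed

lemma growth: "growth N perm H V"
proof
  show "perm \<in> involutions N" by (rule perm_in_involutions)
  show "(H (Suc i) (Suc j), V (Suc i) (Suc j)) = grow (perm (Suc j) = Suc i) (H i (Suc j)) (V (Suc i) j)"
    if "i < N" "j < N" for i j
    using cell[OF that] perm_eq_iff[of "Suc j" "Suc i"] that by simp
  show V: "V (Suc i) 0 = 0" if "i < N" for i
    using that by (rule V_left)
  show "H 0 (Suc j) = 0" if "j < N" for j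
    using V[OF that] V_eq_H_transpose[of "Suc j" 0] that by simp
qed

lemma label_word_perm: "label_word N perm = w"
proof
  fix j
  show "label_word N perm j = w j"
  proof (cases "j \<in> {1..N}")
    case True
    then show ?thesis
      using label_word_eq[OF growth] H_top by simp
  next
    case False
    then have "w j = 0"
      by (rule ballot_zeroD[OF ballot])
    moreover from False have "label_word N perm j = 0"
      unfolding label_word_def by (rule if_not_P)
    ultimately show ?thesis by simp
  qed
qed

end

lemma bij_betw_label_word: "bij_betw (label_word N) (involutions N) (Collect (ballot N))"
  unfolding bij_betw_def
proof (intro conjI inj_label_word equalityI subsetI)
  fix w assume "w \<in> Collect (ballot N)"
  then interpret reverse_growth N w
    by unfold_locales simp
  show "w \<in> label_word N ` involutions N"
    using label_word_perm perm_in_involutions by (metis imageI)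
qed (auto intro: ballot_label_word)

subsection \<open>Conjugate tableaux and involutions avoiding 1234\<close>

text \<open>Turns the rows of the boxes of a standard tableau, listed by increasing entry, into their columns.\<close>

definition conjugate :: "(nat \<Rightarrow> nat) \<Rightarrow> nat \<Rightarrow> nat" where
  "conjugate w j = (if w j = 0 then 0 else occ w j (w j))"

lemma conjugate_pos_iff: "ballot N w \<Longrightarrow> 0 < conjugate w j \<longleftrightarrow> j \<in> {1..N}"
proof (cases "w j = 0")
  case False
  assume "ballot N w"
  with False have "j \<in> {1..N}"
    unfolding ballot_def by (metis gr0I)
  moreover from this have "0 < occ w j (w j)"
    unfolding occ_pos_iff by auto
  ultimately show ?thesis
    using False by (simp add: conjugate_def)
next
  case True
  assume "ballot N w"
  with True show ?thesis
    unfolding ballot_def conjugate_def by (metis less_irrefl)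
qed

lemma finite_occ_ge: "0 < s \<Longrightarrow> finite {r. 0 < r \<and> s \<le> occ w j r}"
proof -
  assume "0 < s"
  have "{r. 0 < r \<and> s \<le> occ w j r} \<subseteq> w ` {1..j}"
  proof
    fix r assume "r \<in> {r. 0 < r \<and> s \<le> occ w j r}"
    with \<open>0 < s\<close> have "0 < occ w j r" by simp
    then show "r \<in> w ` {1..j}" unfolding occ_pos_iff by blast
  qed
  then show ?thesis
    by (rule finite_subset) simp
qed

text \<open>Column \<open>s\<close> has one box in each row of length at least \<open>s\<close>; a
  new box enters it when its row reaches length \<open>s\<close>.\<close>

lemma occ_conjugate:
  "0 < s \<Longrightarrow> occ (conjugate w) j s = card {r. 0 < r \<and> s \<le> occ w j r}"
proof (induction j)
  case (Suc j)
  have "{r. 0 < r \<and> s \<le> occ w (Suc j) r}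
      = {r. 0 < r \<and> s \<le> occ w j r} \<union> (if conjugate w (Suc j) = s then {w (Suc j)} else {})"
    using Suc.prems by (auto simp: occ_Suc conjugate_def of_bool_def split: if_splits)
  moreover have "conjugate w (Suc j) = s \<Longrightarrow> w (Suc j) \<notin> {r. 0 < r \<and> s \<le> occ w j r}"
    by (auto simp: conjugate_def occ_Suc)
  ultimately show ?case
    using Suc finite_occ_ge[OF Suc.prems, of w j] by (auto simp: occ_Suc)
qed simp

lemma ballot_conjugate: "ballot N w \<Longrightarrow> ballot N (conjugate w)"
  unfolding ballot_def[of N "conjugate w"]
  by (auto simp: conjugate_pos_iff occ_conjugate intro!: card_mono finite_occ_ge)

lemma ballot_occ_antimono:
  assumes "ballot N w" "j \<le> N" "0 < r" "r \<le> s"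
  shows "occ w j s \<le> occ w j r"
  using assms(4)
proof (induction s rule: dec_induct)
  case (step s)
  with assms have "occ w j (Suc s) \<le> occ w j s"
    unfolding ballot_def by simp
  with step.IH show ?case by simp
qed simp

lemma ballot_occ_less:
  assumes "ballot N w" "j \<in> {1..N}" "w j < s"
  shows "occ w j s < occ w j (w j)"
proof -
  obtain i where i: "j = Suc i"
    using assms(2) by (cases j) auto
  have "0 < w j"
    using assms by (simp add: ballot_def)
  then have "occ w i s \<le> occ w i (w j)"
    using assms i by (intro ballot_occ_antimono[of N]) auto
  then show ?thesis
    using assms(3) by (simp add: i occ_Suc)
qed

lemma conjugate_conjugate:
  assumes "ballot N w"
  shows "conjugate (conjugate w) = w"
proof
  fix j
  show "conjugate (conjugate w) j = w j"
  proof (cases "j \<in> {1..N}")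
    case True
    then have pos: "0 < w j" "0 < conjugate w j"
      using assms by (simp_all add: conjugate_pos_iff) (simp add: ballot_def)
    \<comment> \<open>The box added at step \<open>j\<close> is a corner: all rows below row
      \<open>w j\<close> are strictly shorter.\<close>
    have "{r. 0 < r \<and> occ w j (w j) \<le> occ w j r} = {1..w j}"
    proof (intro set_eqI iffI)
      fix r assume r: "r \<in> {r. 0 < r \<and> occ w j (w j) \<le> occ w j r}"
      then have "\<not> w j < r"
        using ballot_occ_less[OF assms True, of r] by auto
      with r show "r \<in> {1..w j}" by auto
    next
      fix r assume "r \<in> {1..w j}"
      then show "r \<in> {r. 0 < r \<and> occ w j (w j) \<le> occ w j r}"
        using ballot_occ_antimono[OF assms, of j r "w j"] True by auto
    qed
    then show ?thesis
      using pos occ_conjugate[OF pos(2), of w j] by (simp add: conjugate_def)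
  next
    case False
    then have "w j = 0"
      by (rule ballot_zeroD[OF assms])
    then show ?thesis by (simp add: conjugate_def)
  qed
qed

lemma bij_betw_conjugate: "bij_betw conjugate (Collect (ballot N)) (Collect (ballot N))"
  by (rule bij_betwI[where g = conjugate]) (auto simp: ballot_conjugate conjugate_conjugate)

text \<open>A next box weakly above the previous one extends a row that was at least as long, hence
  lies strictly to its right; a next box strictly below ends a row that is no longer, hence lies
  weakly to its left.\<close>

lemma conjugate_ascent_iff:
  assumes "ballot N w" "j \<in> {1..<N}"
  shows "conjugate w j < conjugate w (Suc j) \<longleftrightarrow> w (Suc j) \<le> w j"
proof -
  have pos: "0 < w j" "0 < w (Suc j)"
    using assms by (auto simp: ballot_def)
  show ?thesis
  proof (cases "w (Suc j) \<le> w j")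
    case True
    then have "occ w j (w j) \<le> occ w j (w (Suc j))"
      using assms pos by (intro ballot_occ_antimono[of N]) auto
    with True show ?thesis
      using pos by (simp add: conjugate_def occ_Suc)
  next
    case False
    then have "occ w (Suc j) (w (Suc j)) \<le> occ w (Suc j) (w j)"
      using assms pos by (intro ballot_occ_antimono[of N]) auto
    with False show ?thesis
      using pos by (simp add: conjugate_def occ_Suc)
  qed
qed

lemma conjugate_le_iff:
  assumes "ballot N w"
  shows "(\<forall>j. conjugate w j \<le> m) \<longleftrightarrow> occ w N 1 \<le> m"
proof
  assume le: "\<forall>j. conjugate w j \<le> m"
  show "occ w N 1 \<le> m"
  proof (cases "occ w N 1 = 0")
    case False
    then have "1 \<in> {r. 0 < r \<and> occ w N 1 \<le> occ w N r}" "0 < occ w N 1"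
      by auto
    then have "0 < occ (conjugate w) N (occ w N 1)"
      using finite_occ_ge by (subst occ_conjugate) (auto simp: card_gt_0_iff)
    then show ?thesis
      using le by (metis occ_pos_iff)
  qed simp
next
  assume le: "occ w N 1 \<le> m"
  show "\<forall>j. conjugate w j \<le> m"
  proof
    fix j
    show "conjugate w j \<le> m"
    proof (cases "w j = 0")
      case False
      then have "j \<in> {1..N}"
        using assms unfolding ballot_def by (metis gr0I)
      then have "occ w j (w j) \<le> occ w N (w j)" "occ w N (w j) \<le> occ w N 1"
        using False by (auto intro!: occ_mono ballot_occ_antimono[OF assms])
      with le show ?thesis by (simp add: conjugate_def)
    qed (simp add: conjugate_def)
  qed
qed

section \<open>Tableaux with at most three rows as words\<close>

definition rank_fun :: "motzkin_step list \<Rightarrow> nat \<Rightarrow> nat" where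
  "rank_fun q j = (if j \<in> {1..length q} then Suc (rank (q ! (j - 1))) else 0)"

lemma occ_rank_fun:
  "k \<le> length q \<Longrightarrow> occ (rank_fun q) k (Suc (rank s)) = count_list (take k q) s"
  by (induction k) (auto simp: occ_Suc rank_fun_def take_Suc_conv_app_nth)

lemma occ_rank_fun_eq_0: "3 < r \<Longrightarrow> occ (rank_fun q) k r = 0"
proof -
  assume r: "3 < r"
  have "rank_fun q i \<le> 3" for i
    using rank_le_2[of "q ! (i - 1)"] by (simp add: rank_fun_def)
  with r have "rank_fun q i \<noteq> r" for i
    by (metis not_le)
  then show ?thesis by (simp add: occ_def)
qed

lemma ballot_rank_fun: "ballot (length q) (rank_fun q) \<longleftrightarrow> lattice_from 0 0 q"
proof -
  have "(\<forall>r>0. occ (rank_fun q) k (Suc r) \<le> occ (rank_fun q) k r) \<longleftrightarrow>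
      count_list (take k q) Horizontal \<le> count_list (take k q) Up \<and>
      count_list (take k q) Down \<le> count_list (take k q) Horizontal" (is "?L \<longleftrightarrow> ?R") if "k \<le> length q" for k
  proof -
    note count = occ_rank_fun[OF that, of Up] occ_rank_fun[OF that, of Horizontal] occ_rank_fun[OF that, of Down]
    have "?L \<longleftrightarrow> occ (rank_fun q) k (Suc 1) \<le> occ (rank_fun q) k 1 \<and> occ (rank_fun q) k (Suc 2) \<le> occ (rank_fun q) k 2"
      (is "_ \<longleftrightarrow> ?M")
    proof
      assume ?M
      show ?L
      proof (intro allI impI)
        fix r :: nat assume "0 < r"
        then consider "r = 1" | "r = 2" | "3 < Suc r" by linarith
        then show "occ (rank_fun q) k (Suc r) \<le> occ (rank_fun q) k r"
          using \<open>?M\<close> occ_rank_fun_eq_0[of "Suc r" q k] by cases auto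
      qed
    qed (simp only: zero_less_one zero_less_numeral)
    with count show ?thesis by (simp add: numeral_2_eq_2)
  qed
  then show ?thesis
    unfolding ballot_def lattice_from_iff_count by (auto simp: rank_fun_def)
qed

lemma bij_betw_rank_fun:
  "bij_betw rank_fun {q. length q = N \<and> lattice_from 0 0 q} {c \<in> Collect (ballot N). \<forall>j. c j \<le> 3}"
  unfolding bij_betw_def
proof (intro conjI equalityI subsetI)
  show "inj_on rank_fun {q. length q = N \<and> lattice_from 0 0 q}"
  proof (rule inj_onI)
    fix p q
    assume pq: "p \<in> {q. length q = N \<and> lattice_from 0 0 q}" "q \<in> {q. length q = N \<and> lattice_from 0 0 q}"
      "rank_fun p = rank_fun q"
    show "p = q"
    proof (rule nth_equalityI)
      fix i assume i: "i < length p"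
      have "rank_fun p (Suc i) = rank_fun q (Suc i)"
        using pq(3) by simp
      with i pq(1,2) show "p ! i = q ! i"
        by (simp add: rank_fun_def)
    qed (use pq in simp)
  qed
  show "c \<in> {c \<in> Collect (ballot N). \<forall>j. c j \<le> 3}"
    if "c \<in> rank_fun ` {q. length q = N \<and> lattice_from 0 0 q}" for c
  proof -
    from that obtain q where q: "c = rank_fun q" "length q = N" "lattice_from 0 0 q"
      by blast
    moreover have "rank_fun q j \<le> 3" for j
      using rank_le_2[of "q ! (j - 1)"] by (simp add: rank_fun_def)
    ultimately show ?thesis
      using ballot_rank_fun[of q] by simp
  qed
  fix c assume c: "c \<in> {c \<in> Collect (ballot N). \<forall>j. c j \<le> 3}"
  define step where "step r = (if r = 1 then Up else if r = 2 then Horizontal else Down)" for r :: nat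
  define q where "q = map (\<lambda>j. step (c j)) [1..<Suc N]"
  have length_q: "length q = N"
    by (simp add: q_def)
  have nth_q: "q ! (j - 1) = step (c j)" if "j \<in> {1..N}" for j
  proof -
    have "j - 1 < length [1..<Suc N]" "1 + (j - 1) = j"
      using that by auto
    then show ?thesis
      unfolding q_def by (simp only: nth_map nth_upt length_upt)
  qed
  have rank_fun_q: "rank_fun q j = (if j \<in> {1..N} then Suc (rank (step (c j))) else 0)" for j
    unfolding rank_fun_def length_q using nth_q by (simp only: cong: if_cong)
  have "rank_fun q j = c j" for j
  proof (cases "j \<in> {1..N}")
    case True
    then have "0 < c j" "c j \<le> 3"
      using ballot_posD[of N c] c by simp_all
    then have "Suc (rank (step (c j))) = c j"
      by (auto simp: step_def)
    with True show ?thesis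
      unfolding rank_fun_q by simp
  next
    case False
    then have "c j = 0"
      using ballot_zeroD[of N c] c by simp
    with False show ?thesis
      unfolding rank_fun_q by (simp only: if_False)
  qed
  then have c_eq: "c = rank_fun q" by (intro ext) simp
  then have "lattice_from 0 0 q"
    using c ballot_rank_fun[of q] length_q by simp
  with c_eq length_q show "c \<in> rank_fun ` {q. length q = N \<and> lattice_from 0 0 q}"
    by (intro image_eqI) simp_all
qed

lemma label_word_ascent_iff:
  assumes "\<pi> \<in> involutions N" "i \<in> {1..<N}"
  shows "\<pi> i < \<pi> (Suc i) \<longleftrightarrow> label_word N \<pi> (Suc i) \<le> label_word N \<pi> i"
proof -
  obtain j where "i = Suc j"
    using assms(2) by (cases i) auto
  then show ?thesis
    using growth.top_ascent_iff[OF growth_growth_labels[OF assms(1)], of j] assms(2)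
    by (simp add: label_word_def del: growth_labels.simps)
qed

lemma avoids_1234_iff_occ:
  assumes "\<pi> \<in> involutions N"
  shows "avoids N \<pi> [1, 2, 3, 4] \<longleftrightarrow> occ (label_word N \<pi>) N 1 \<le> 3"
proof -
  have "occ (label_word N \<pi>) N 1 = occ (\<lambda>j. fst (growth_labels \<pi> N j)) N 1"
    by (rule occ_cong) (simp add: label_word_def)
  then show ?thesis
    using growth.le_occ_1_iff[OF growth_growth_labels[OF assms], of N N 4] increasing_chain_4_iff[OF assms]
    by auto
qed

lemma card_avoiding_1234:
  "card {\<pi> \<in> involutions N. (\<forall>i\<in>{1..<N}. \<pi> i < \<pi> (i + 1) \<longleftrightarrow> (odd i \<longleftrightarrow> up)) \<and> avoids N \<pi> [1, 2, 3, 4]}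
    = card {q. length q = N \<and> lattice_from 0 0 q \<and> zigzag up q}"
proof -
  have "card {\<pi> \<in> involutions N. (\<forall>i\<in>{1..<N}. \<pi> i < \<pi> (i + 1) \<longleftrightarrow> (odd i \<longleftrightarrow> up)) \<and> avoids N \<pi> [1, 2, 3, 4]}
      = card {c \<in> Collect (ballot N). (\<forall>i\<in>{1..<N}. c i < c (i + 1) \<longleftrightarrow> (odd i \<longleftrightarrow> up)) \<and> (\<forall>j. c j \<le> 3)}"
  proof (rule card_Collect_bij_betw[OF bij_betw_trans[OF bij_betw_label_word bij_betw_conjugate]])
    fix \<pi> assume \<pi>: "\<pi> \<in> involutions N"
    note ballot = ballot_label_word[OF \<pi>]
    show "(\<forall>i\<in>{1..<N}. \<pi> i < \<pi> (i + 1) \<longleftrightarrow> (odd i \<longleftrightarrow> up)) \<and> avoids N \<pi> [1, 2, 3, 4] \<longleftrightarrow>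
      (\<forall>i\<in>{1..<N}. (conjugate \<circ> label_word N) \<pi> i < (conjugate \<circ> label_word N) \<pi> (i + 1) \<longleftrightarrow> (odd i \<longleftrightarrow> up)) \<and>
      (\<forall>j. (conjugate \<circ> label_word N) \<pi> j \<le> 3)"
      unfolding o_apply conjugate_le_iff[OF ballot] avoids_1234_iff_occ[OF \<pi>]
      using label_word_ascent_iff[OF \<pi>] conjugate_ascent_iff[OF ballot] by simp
  qed
  also have "\<dots> = card {c \<in> {c \<in> Collect (ballot N). \<forall>j. c j \<le> 3}. \<forall>i\<in>{1..<N}. c i < c (i + 1) \<longleftrightarrow> (odd i \<longleftrightarrow> up)}"
    by (rule arg_cong[where f = card]) auto
  also have "\<dots> = card {q \<in> {q. length q = N \<and> lattice_from 0 0 q}. zigzag up q}"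
  proof (rule card_Collect_bij_betw[OF bij_betw_rank_fun, symmetric])
    fix q assume "q \<in> {q. length q = N \<and> lattice_from 0 0 q}"
    then have "length q = N" by simp
    then show "zigzag up q \<longleftrightarrow> (\<forall>i\<in>{1..<N}. rank_fun q i < rank_fun q (i + 1) \<longleftrightarrow> (odd i \<longleftrightarrow> up))"
      unfolding all_positions_iff zigzag_iff_nth by (simp add: rank_fun_def)
  qed
  finally show ?thesis by simp
qed

subsection \<open>Reverse complement\<close>

lemma AI_eq_ascents: "AI N = {\<pi> \<in> involutions N. \<forall>i\<in>{1..<N}. \<pi> i < \<pi> (i + 1) \<longleftrightarrow> (odd i \<longleftrightarrow> True)}"
  by (auto simp: AI_def alternating_def involutions_eq)

lemma RAI_eq_descents: "RAI N = {\<pi> \<in> involutions N. \<forall>i\<in>{1..<N}. \<pi> i > \<pi> (i + 1) \<longleftrightarrow> (odd i \<longleftrightarrow> True)}"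
  by (auto simp: RAI_def reverse_alternating_def involutions_eq)

lemma ascent_iff_not_descent:
  assumes "\<pi> \<in> involutions N"
  shows "(\<pi> i < \<pi> (i + 1) \<longleftrightarrow> (odd i \<longleftrightarrow> up)) \<longleftrightarrow> (\<pi> i > \<pi> (i + 1) \<longleftrightarrow> (odd i \<longleftrightarrow> \<not> up))"
proof -
  have "\<pi> i \<noteq> \<pi> (i + 1)"
    using involutionsD(4)[OF assms, of i "i + 1"] by simp
  then have "\<pi> i < \<pi> (i + 1) \<longleftrightarrow> \<not> \<pi> i > \<pi> (i + 1)"
    by linarith
  then show ?thesis by blast
qed

lemma AI_eq_descents: "AI N = {\<pi> \<in> involutions N. \<forall>i\<in>{1..<N}. \<pi> i > \<pi> (i + 1) \<longleftrightarrow> (odd i \<longleftrightarrow> False)}"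
  unfolding AI_eq_ascents
  by (intro Collect_cong conj_cong refl ball_cong) (simp only: ascent_iff_not_descent not_True_eq_False)

lemma RAI_eq_ascents: "RAI N = {\<pi> \<in> involutions N. \<forall>i\<in>{1..<N}. \<pi> i < \<pi> (i + 1) \<longleftrightarrow> (odd i \<longleftrightarrow> False)}"
  unfolding RAI_eq_descents
  by (intro Collect_cong conj_cong refl ball_cong) (simp only: ascent_iff_not_descent not_False_eq_True)

lemma card_RAI_avoiding_4321:
  "card (RAI_avoiding N [4, 3, 2, 1]) = card {q. length q = N \<and> motzkin_from 0 q \<and> zigzag True q}"
  unfolding card_avoiding_4321[symmetric] RAI_avoiding_def RAI_eq_descents mem_Collect_eq conj_assoc ..

lemma card_AI_avoiding_4321:
  "card (AI_avoiding N [4, 3, 2, 1]) = card {q. length q = N \<and> motzkin_from 0 q \<and> zigzag False q}"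
  unfolding card_avoiding_4321[symmetric] AI_avoiding_def AI_eq_descents mem_Collect_eq conj_assoc ..

lemma card_AI_avoiding_1234:
  "card (AI_avoiding N [1, 2, 3, 4]) = card {q. length q = N \<and> lattice_from 0 0 q \<and> zigzag True q}"
  unfolding card_avoiding_1234[symmetric] AI_avoiding_def AI_eq_ascents mem_Collect_eq conj_assoc ..

lemma card_RAI_avoiding_1234:
  "card (RAI_avoiding N [1, 2, 3, 4]) = card {q. length q = N \<and> lattice_from 0 0 q \<and> zigzag False q}"
  unfolding card_avoiding_1234[symmetric] RAI_avoiding_def RAI_eq_ascents mem_Collect_eq conj_assoc ..

text \<open>A half turn of the permutation matrix; it preserves the symmetry of an involution and
  both patterns.\<close>

definition reverse_complement :: "nat \<Rightarrow> (nat \<Rightarrow> nat) \<Rightarrow> nat \<Rightarrow> nat" where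
  "reverse_complement N \<pi> i = (if i \<in> {1..N} then N + 1 - \<pi> (N + 1 - i) else i)"

lemma reverse_complement_eq: "i \<in> {1..N} \<Longrightarrow> reverse_complement N \<pi> i = N + 1 - \<pi> (N + 1 - i)"
  unfolding reverse_complement_def by (rule if_P)

lemma reverse_complement_outside: "i \<notin> {1..N} \<Longrightarrow> reverse_complement N \<pi> i = i"
  unfolding reverse_complement_def by (rule if_not_P)

lemma reflect_in: "i \<in> {1..N} \<Longrightarrow> N + 1 - i \<in> {1..N}" for N :: nat
  by auto

lemma reverse_complement_in_involutions:
  assumes "\<pi> \<in> involutions N"
  shows "reverse_complement N \<pi> \<in> involutions N"
proof -
  have "reverse_complement N \<pi> (reverse_complement N \<pi> i) = i" for i
  proof (cases "i \<in> {1..N}")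
    case True
    have "\<pi> (N + 1 - i) \<in> {1..N}"
      using involutionsD(3)[OF assms] reflect_in[OF True] .
    moreover from this have "N + 1 - (N + 1 - \<pi> (N + 1 - i)) = \<pi> (N + 1 - i)"
      by simp
    ultimately show ?thesis
      using True reflect_in[of "\<pi> (N + 1 - i)" N]
      by (simp add: reverse_complement_eq involutionsD(1)[OF assms])
  qed (simp add: reverse_complement_outside)
  then show ?thesis
    by (simp add: involutions_def reverse_complement_outside)
qed

lemma reverse_complement_twice:
  assumes "\<pi> \<in> involutions N"
  shows "reverse_complement N (reverse_complement N \<pi>) = \<pi>"
proof
  fix i show "reverse_complement N (reverse_complement N \<pi>) i = \<pi> i"
  proof (cases "i \<in> {1..N}")
    case True
    then have "N + 1 - (N + 1 - i) = i" "\<pi> i \<in> {1..N}"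
      using involutionsD(3)[OF assms] by auto
    then show ?thesis
      using True reflect_in[OF True] by (simp add: reverse_complement_eq)
  next
    case False
    then show ?thesis
      using involutionsD(2)[OF assms False] by (simp only: reverse_complement_outside[OF False])
  qed
qed

lemma reverse_complement_less_iff:
  assumes "\<pi> \<in> involutions N" "i \<in> {1..N}" "j \<in> {1..N}"
  shows "reverse_complement N \<pi> i < reverse_complement N \<pi> j \<longleftrightarrow> \<pi> (N + 1 - j) < \<pi> (N + 1 - i)"
  using involutionsD(3)[OF assms(1) reflect_in[OF assms(2)]] involutionsD(3)[OF assms(1) reflect_in[OF assms(3)]]
  by (simp add: reverse_complement_eq[OF assms(2)] reverse_complement_eq[OF assms(3)]) linarith

lemma avoids_reverse_complement:
  assumes \<pi>: "\<pi> \<in> involutions N" and \<tau>: "\<tau> \<in> {[1, 2, 3, 4], [4, 3, 2, 1]}" and avoids: "avoids N \<pi> \<tau>"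
  shows "avoids N (reverse_complement N \<pi>) \<tau>"
proof -
  let ?\<rho> = "reverse_complement N \<pi>"
  have False if *: "1 \<le> a" "a < b" "b < c" "c < d" "d \<le> N"
    and pattern: "\<tau> = [1, 2, 3, 4] \<and> ?\<rho> a < ?\<rho> b \<and> ?\<rho> b < ?\<rho> c \<and> ?\<rho> c < ?\<rho> d \<or>
      \<tau> = [4, 3, 2, 1] \<and> ?\<rho> b < ?\<rho> a \<and> ?\<rho> c < ?\<rho> b \<and> ?\<rho> d < ?\<rho> c" for a b c d
  proof -
    have "1 \<le> N + 1 - d" "N + 1 - d < N + 1 - c" "N + 1 - c < N + 1 - b" "N + 1 - b < N + 1 - a" "N + 1 - a \<le> N"
      using * by auto
    moreover have "a \<in> {1..N}" "b \<in> {1..N}" "c \<in> {1..N}" "d \<in> {1..N}"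
      using * by auto
    note pattern[unfolded reverse_complement_less_iff[OF \<pi> this(1,2)] reverse_complement_less_iff[OF \<pi> this(2,3)]
        reverse_complement_less_iff[OF \<pi> this(3,4)] reverse_complement_less_iff[OF \<pi> this(2,1)]
        reverse_complement_less_iff[OF \<pi> this(3,2)] reverse_complement_less_iff[OF \<pi> this(4,3)]]
    ultimately show False
      using avoids avoids_1234_iff[of N \<pi>] avoids_4321_iff[of N \<pi>] by blast
  qed
  with \<tau> show ?thesis
    using avoids_1234_iff[of N ?\<rho>] avoids_4321_iff[of N ?\<rho>] by blast
qed

lemma reverse_complement_descent_iff:
  assumes "\<pi> \<in> involutions N" "i \<in> {1..<N}"
  shows "reverse_complement N \<pi> (i + 1) < reverse_complement N \<pi> i \<longleftrightarrow> \<pi> (N - i + 1) < \<pi> (N - i)"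
  using reverse_complement_less_iff[OF assms(1), of "i + 1" i] assms(2) by (simp add: Suc_diff_le)

text \<open>The half turn moves a descent at \<open>N - i\<close> to \<open>i\<close>, and for odd
  \<open>N\<close> these positions have opposite parity.\<close>

lemma card_AI_eq_card_RAI_odd:
  assumes N: "odd N" and \<tau>: "\<tau> \<in> {[1, 2, 3, 4], [4, 3, 2, 1]}"
  shows "card (AI_avoiding N \<tau>) = card (RAI_avoiding N \<tau>)"
proof -
  have AI: "\<pi> \<in> AI N \<longleftrightarrow> \<pi> \<in> involutions N \<and> (\<forall>i\<in>{1..<N}. \<pi> (i + 1) < \<pi> i \<longleftrightarrow> even i)" for \<pi>
    by (simp add: AI_eq_descents)
  have RAI: "\<pi> \<in> RAI N \<longleftrightarrow> \<pi> \<in> involutions N \<and> (\<forall>i\<in>{1..<N}. \<pi> (i + 1) < \<pi> i \<longleftrightarrow> odd i)" for \<pi>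
    by (simp add: RAI_eq_descents)
  \<comment> \<open>The parity predicate \<open>P\<close> lets one argument serve both directions of
    the bijection.\<close>
  have descent: "reverse_complement N \<pi> (i + 1) < reverse_complement N \<pi> i \<longleftrightarrow> P i"
    if "\<pi> \<in> involutions N" "\<forall>i\<in>{1..<N}. \<pi> (i + 1) < \<pi> i \<longleftrightarrow> \<not> P i" "i \<in> {1..<N}" "P = even \<or> P = odd" for \<pi> i P
  proof -
    have "N - i \<in> {1..<N}"
      using that(3) by auto
    then have "\<pi> (N - i + 1) < \<pi> (N - i) \<longleftrightarrow> \<not> P (N - i)"
      by (rule bspec[OF that(2)])
    moreover have "even (N - i) \<longleftrightarrow> odd i"
      using that(3) N by simp
    with that(4) have "P (N - i) \<longleftrightarrow> \<not> P i"
      by (elim disjE) simp_all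
    ultimately show ?thesis
      unfolding reverse_complement_descent_iff[OF that(1,3)] by blast
  qed
  have "bij_betw (reverse_complement N) (AI_avoiding N \<tau>) (RAI_avoiding N \<tau>)"
  proof (rule bij_betwI[where g = "reverse_complement N"])
    have "reverse_complement N \<pi> \<in> RAI N" if "\<pi> \<in> AI N" for \<pi>
      unfolding RAI using that[unfolded AI] descent[of \<pi> odd] reverse_complement_in_involutions by blast
    then show "reverse_complement N \<in> AI_avoiding N \<tau> \<rightarrow> RAI_avoiding N \<tau>"
      unfolding AI_avoiding_def RAI_avoiding_def using avoids_reverse_complement[OF _ \<tau>] AI by blast
    have "reverse_complement N \<pi> \<in> AI N" if "\<pi> \<in> RAI N" for \<pi>
      unfolding AI using that[unfolded RAI] descent[of \<pi> even] reverse_complement_in_involutions by blast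
    then show "reverse_complement N \<in> RAI_avoiding N \<tau> \<rightarrow> AI_avoiding N \<tau>"
      unfolding AI_avoiding_def RAI_avoiding_def using avoids_reverse_complement[OF _ \<tau>] RAI by blast
    show "reverse_complement N (reverse_complement N \<pi>) = \<pi>" if "\<pi> \<in> AI_avoiding N \<tau>" for \<pi>
      using that unfolding AI_avoiding_def AI by (blast intro: reverse_complement_twice)
    show "reverse_complement N (reverse_complement N \<pi>) = \<pi>" if "\<pi> \<in> RAI_avoiding N \<tau>" for \<pi>
      using that unfolding RAI_avoiding_def RAI by (blast intro: reverse_complement_twice)
  qed
  then show ?thesis
    by (rule bij_betw_same_card)
qed

theorem corollary5p6:
  fixes n :: nat
  assumes "n \<ge> 1"
  shows "int (card (RAI_avoiding (2 * n) [4, 3, 2, 1])) = motzkin (int n)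
       \<and> int (card (AI_avoiding (2 * n) [1, 2, 3, 4])) = motzkin (int n)
       \<and> int (card (RAI_avoiding (2 * n - 1) [1, 2, 3, 4])) = motzkin (int n) - motzkin (int n - 2)
       \<and> int (card (AI_avoiding (2 * n - 1) [4, 3, 2, 1])) = motzkin (int n) - motzkin (int n - 2)
       \<and> int (card (RAI_avoiding (2 * n - 1) [4, 3, 2, 1])) = motzkin (int n) - motzkin (int n - 2)
       \<and> int (card (AI_avoiding (2 * n - 1) [1, 2, 3, 4])) = motzkin (int n) - motzkin (int n - 2)"
proof -
  have "odd (2 * n - 1)"
    using assms by simp
  note swap = card_AI_eq_card_RAI_odd[OF this]
  have "card (RAI_avoiding (2 * n - 1) [4, 3, 2, 1]) = card (AI_avoiding (2 * n - 1) [4, 3, 2, 1])"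
    "card (AI_avoiding (2 * n - 1) [1, 2, 3, 4]) = card (RAI_avoiding (2 * n - 1) [1, 2, 3, 4])"
    using swap[of "[4, 3, 2, 1]"] swap[of "[1, 2, 3, 4]"] by simp_all
  then show ?thesis
    using card_motzkin_zigzag_even[of n] card_lattice_zigzag_even[of n]
      card_motzkin_zigzag_odd[OF assms] card_lattice_zigzag_odd[OF assms]
    by (simp only: card_RAI_avoiding_4321 card_AI_avoiding_4321 card_AI_avoiding_1234 card_RAI_avoiding_1234 simp_thms)
qed

end
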